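(* Let $R\in\mathcal{C}$ and let $\rho:G\to\mathrm{GL}_2(R)$ be a lift of $\overline{\rho}$. The following statements are equivalent: (i) $\rho$ is dihedral in the sense that there is a character $\chi:H\to R^\times$ lifting $\overline{\chi}$ such that $\rho$ is equivalent to $\mathrm{Ind}_H^G(\chi)_R$; (ii) the action of $\overline{H}^{\mathrm{ad}}$ on $\Gamma_\rho$ is trivial (and hence $\rho(H)\cong\Gamma_\rho\times s(\overline{\rho}(H))$); (iii) the action of $\overline{H}^{\mathrm{ad}}$ on $\Gamma_\rho/\Phi(\Gamma_\rho)$ is trivial.
   Context: Let $p$ be a prime, $\mathbb{F}$ a finite field of characteristic $p$, $W(\mathbb{F})$ its ring of Witt vectors, and $\mathcal{C}$ the category of complete local Noetherian $W(\mathbb{F})$-algebras with residue field $\mathbb{F}$; for $R\in\mathcal{C}$ let $\mathfrak{m}_R$ be its maximal ideal. All representations and characters are continuous. Let $G$ be a profinite group, $H\lhd G$ an open normal subgroup of index $2$ and $\sigma\in G\setminus H$. For a topological ring $R$ and a character $\chi:H\to R^\times$, $\mathrm{Ind}_H^G(\chi)_R=\{f:G\to R\mid f(hg)=\chi(h)f(g)\ \forall h\in H, g\in G\}$ is the free rank-$2$ $R$-module with $G$-action $(\tilde g f)(g)=f(g\tilde g)$. Let $\overline{\chi}:H\to\mathbb{F}^\times$ be a character with $\overline{\chi}\neq\overline{\chi}^\sigma$, where $\overline{\chi}^\sigma(h)=\overline{\chi}(\sigma h\sigma^{-1})$, and let $\overline{\rho}=\mathrm{Ind}_H^G(\overline{\chi})_{\mathbb{F}}:G\to\mathrm{GL}_2(\mathbb{F})$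 (it is absolutely irreducible). A lift of $\overline\rho$ is a representation $\rho:G\to\mathrm{GL}_2(R)$ with $R\in\mathcal{C}$ whose reduction modulo $\mathfrak{m}_R$ is $\overline\rho$. For such $\rho$ let $\Gamma_\rho=\ker(\rho(G)\to\overline{\rho}(G))$ (reduction modulo $\mathfrak{m}_R$), a pro-$p$ group. For a pro-$p$ group $\Gamma$, $\Phi(\Gamma)$ denotes the closure of $\Gamma^p[\Gamma,\Gamma]$. Let $\mathrm{ad}(\overline\rho)$ be the action of $G$ on $M_2(\mathbb{F})$ by conjugation via $\overline\rho$, and $\overline{H}^{\mathrm{ad}}=\mathrm{ad}(\overline\rho)(H)$, a quotient of $\overline\rho(H)$. The exact sequence $1\to\Gamma_\rho\to\rho(H)\to\overline\rho(H)\to 1$ splits; fix a splitting $s:\overline\rho(H)\to\rho(H)$. Then $\overline\rho(H)$ acts on $\Gamma_\rho$ by $x\mapsto s(y)xs(y)^{-1}$; this action factors through $\overline{H}^{\mathrm{ad}}$, and induces an action of $\overline{H}^{\mathrm{ad}}$ on $\Gamma_\rho/\Phi(\Gamma_\rho)$. *)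

theory Defs
  imports
    "HOL-Analysis.Analysis"
    "HOL-Algebra.Algebra"
    "HOL-Algebra.Algebraic_Closure_Type"
    "HOL-Library.Poly_Mapping"
begin

section \<open>Witt vectors\<close>

text \<open>
  Integer polynomials in the variables \<open>X\<^sub>0, X\<^sub>1, \<dots>\<close> (indexed by \<open>Inl\<close>) and
  \<open>Y\<^sub>0, Y\<^sub>1, \<dots>\<close> (indexed by \<open>Inr\<close>).
\<close>

type_synonym witt_mpoly = "((nat + nat) \<Rightarrow>\<^sub>0 nat) \<Rightarrow>\<^sub>0 int"

definition mp_var :: "nat + nat \<Rightarrow> witt_mpoly" where
  "mp_var v = Poly_Mapping.single (Poly_Mapping.single v 1) 1"

definition mp_eval :: "(nat + nat \<Rightarrow> 'a::comm_ring_1) \<Rightarrow> witt_mpoly \<Rightarrow> 'a" where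
  "mp_eval a P = (\<Sum>m\<in>Poly_Mapping.keys P. of_int (Poly_Mapping.lookup P m) *
      (\<Prod>v\<in>Poly_Mapping.keys m. a v ^ Poly_Mapping.lookup m v))"

definition ghost :: "nat \<Rightarrow> (nat \<Rightarrow> 'a::comm_ring_1) \<Rightarrow> nat \<Rightarrow> 'a" where
  "ghost p x n = (\<Sum>i\<le>n. of_nat p ^ i * x i ^ (p ^ (n - i)))"

text \<open>
  The polynomials \<open>S\<^sub>0, S\<^sub>1, \<dots>\<close> determined by
  \<open>ghost p S n = bop (ghost p X n) (ghost p Y n)\<close> for all \<open>n\<close>, with \<open>bop\<close> addition or
  multiplication. The coefficientwise division by \<open>p ^ n\<close> is exact by Witt's
  integrality theorem.
\<close>

function witt_poly :: "nat \<Rightarrow> (witt_mpoly \<Rightarrow> witt_mpoly \<Rightarrow> witt_mpoly) \<Rightarrow> nat \<Rightarrow> witt_mpoly" where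
  "witt_poly p bop n = Poly_Mapping.map (\<lambda>c. c div int p ^ n)
     (bop (ghost p (\<lambda>i. mp_var (Inl i)) n) (ghost p (\<lambda>i. mp_var (Inr i)) n)
      - (\<Sum>i\<in>{..<n}. of_nat p ^ i * witt_poly p bop i ^ (p ^ (n - i))))"
  by pat_completeness auto
termination
  by (relation "Wellfounded.measure (\<lambda>(p, bop, n). n)") auto

declare witt_poly.simps [simp del]

definition witt_ring :: "nat \<Rightarrow> (nat \<Rightarrow> 'a::comm_ring_1) ring" where
  "witt_ring p = \<lparr>carrier = UNIV,
     monoid.mult = (\<lambda>x y n. mp_eval (case_sum x y) (witt_poly p (*) n)),
     one = (\<lambda>n. if n = 0 then 1 else 0),
     ring.zero = (\<lambda>n. 0),
     add = (\<lambda>x y n. mp_eval (case_sum x y) (witt_poly p (+) n))\<rparr>"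


section \<open>Complete local Noetherian rings\<close>

abbreviation type_ring :: "'r::comm_ring_1 ring" where
  "type_ring \<equiv> ring_of_type_algebra"

definition max_ideal :: "'r::comm_ring_1 set" where
  "max_ideal = (THE M. maximalideal M (type_ring :: 'r ring))"

definition max_ideal_pow :: "nat \<Rightarrow> 'r::comm_ring_1 set" where
  "max_ideal_pow n = max_ideal [^]\<^bsub>ideals_set (type_ring :: 'r ring)\<^esub> n"

definition adic_topology :: "'r::comm_ring_1 topology" where
  "adic_topology = topology_generated_by {{y. y - x \<in> max_ideal_pow n} | x n. True}"

text \<open>
  The two conjuncts are injectivity and surjectivity of the canonical map from the ring
  to the inverse limit of its quotients by the powers of the maximal ideal.
\<close>

definition adic_complete :: "'r::comm_ring_1 itself \<Rightarrow> bool" where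
  "adic_complete _ \<longleftrightarrow>
     (\<Inter>n. max_ideal_pow n) = {0 :: 'r} \<and>
     (\<forall>u :: nat \<Rightarrow> 'r. (\<forall>n. u (Suc n) - u n \<in> max_ideal_pow n) \<longrightarrow>
        (\<exists>l. \<forall>n. l - u n \<in> max_ideal_pow n))"

text \<open>
  The type \<open>'r\<close> with structure map \<open>\<alpha>\<close> from the Witt vectors of \<open>'f\<close> and residue map \<open>\<pi>\<close>
  is a complete local Noetherian \<open>W('f)\<close>-algebra with residue field \<open>'f\<close>. The residue map of
  \<open>W('f)\<close> is the zeroth component.
\<close>

definition coefficient_algebra ::
  "nat \<Rightarrow> ((nat \<Rightarrow> 'f::field) \<Rightarrow> 'r::comm_ring_1) \<Rightarrow> ('r \<Rightarrow> 'f) \<Rightarrow> bool" where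
  "coefficient_algebra p \<alpha> \<pi> \<longleftrightarrow>
     noetherian_ring (type_ring :: 'r ring) \<and>
     (\<exists>!M. maximalideal M (type_ring :: 'r ring)) \<and>
     adic_complete TYPE('r) \<and>
     \<alpha> \<in> ring_hom (witt_ring p) type_ring \<and>
     \<pi> \<in> ring_hom type_ring type_ring \<and>
     surj \<pi> \<and>
     a_kernel type_ring type_ring \<pi> = max_ideal \<and>
     (\<forall>w. \<pi> (\<alpha> w) = w 0)"


section \<open>Profinite groups, characters and two-dimensional representations\<close>

definition topological_group :: "('g, 'x) monoid_scheme \<Rightarrow> 'g topology \<Rightarrow> bool" where
  "topological_group G T \<longleftrightarrow>
     group G \<and> topspace T = carrier G \<and>
     continuous_map (prod_topology T T) T (\<lambda>(x, y). x \<otimes>\<^bsub>G\<^esub> y) \<and>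
     continuous_map T T (\<lambda>x. inv\<^bsub>G\<^esub> x)"

definition profinite_group :: "('g, 'x) monoid_scheme \<Rightarrow> 'g topology \<Rightarrow> bool" where
  "profinite_group G T \<longleftrightarrow>
     topological_group G T \<and> compact_space T \<and> Hausdorff_space T \<and>
     (\<forall>x\<in>topspace T. connected_component_of_set T x = {x})"

definition is_character ::
  "('g, 'x) monoid_scheme \<Rightarrow> 'g topology \<Rightarrow> 'g set \<Rightarrow> 'r::comm_ring_1 topology \<Rightarrow>
     ('g \<Rightarrow> 'r) \<Rightarrow> bool" where
  "is_character G T H \<T> chi \<longleftrightarrow>
     chi \<in> hom (G\<lparr>carrier := H\<rparr>) (units_of type_ring) \<and>
     continuous_map (subtopology T H) \<T> chi"

definition GL2 :: "('r::comm_ring_1 ^ 2 ^ 2) monoid" where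
  "GL2 = \<lparr>carrier = {A. invertible A}, monoid.mult = (**), one = mat 1\<rparr>"

definition GL2_topology :: "'r::comm_ring_1 topology \<Rightarrow> ('r ^ 2 ^ 2) topology" where
  "GL2_topology \<T> =
     pullback_topology (carrier GL2) (\<lambda>A (i, j). A $ i $ j) (product_topology (\<lambda>_. \<T>) UNIV)"

definition is_representation ::
  "('g, 'x) monoid_scheme \<Rightarrow> 'g topology \<Rightarrow> 'r::comm_ring_1 topology \<Rightarrow>
     ('g \<Rightarrow> 'r ^ 2 ^ 2) \<Rightarrow> bool" where
  "is_representation G T \<T> \<rho> \<longleftrightarrow> \<rho> \<in> hom G GL2 \<and> continuous_map T (GL2_topology \<T>) \<rho>"

definition Ind :: "('g, 'x) monoid_scheme \<Rightarrow> 'g set \<Rightarrow> ('g \<Rightarrow> 'r::comm_ring_1) \<Rightarrow> ('g \<Rightarrow> 'r) set" where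
  "Ind G H chi = {f \<in> extensional (carrier G).
     \<forall>h\<in>H. \<forall>g\<in>carrier G. f (h \<otimes>\<^bsub>G\<^esub> g) = chi h * f g}"

definition Ind_act :: "('g, 'x) monoid_scheme \<Rightarrow> 'g \<Rightarrow> ('g \<Rightarrow> 'r) \<Rightarrow> ('g \<Rightarrow> 'r)" where
  "Ind_act G k f = (\<lambda>g\<in>carrier G. f (g \<otimes>\<^bsub>G\<^esub> k))"

text \<open>
  \<open>\<phi>\<close> is an isomorphism of modules with \<open>G\<close>-action from the space of column vectors, on which
  \<open>G\<close> acts through \<open>\<rho>\<close>, to the induced module; equivalently, \<open>\<rho>\<close> is the matrix form of the
  induced module in the basis of images of the standard unit vectors.
\<close>

definition equivalent_to_Ind ::
  "('g, 'x) monoid_scheme \<Rightarrow> 'g set \<Rightarrow> ('g \<Rightarrow> 'r::comm_ring_1) \<Rightarrow> ('g \<Rightarrow> 'r ^ 2 ^ 2) \<Rightarrow> bool" where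
  "equivalent_to_Ind G H chi \<rho> \<longleftrightarrow>
     (\<exists>\<phi> :: 'r ^ 2 \<Rightarrow> 'g \<Rightarrow> 'r.
        bij_betw \<phi> UNIV (Ind G H chi) \<and>
        (\<forall>u v. \<phi> (u + v) = (\<lambda>g\<in>carrier G. \<phi> u g + \<phi> v g)) \<and>
        (\<forall>c v. \<phi> (c *s v) = (\<lambda>g\<in>carrier G. c * \<phi> v g)) \<and>
        (\<forall>k\<in>carrier G. \<forall>v. \<phi> (\<rho> k *v v) = Ind_act G k (\<phi> v)))"

definition dihedral ::
  "('g, 'x) monoid_scheme \<Rightarrow> 'g topology \<Rightarrow> 'g set \<Rightarrow> ('r::comm_ring_1 \<Rightarrow> 'f::field) \<Rightarrow>
     ('g \<Rightarrow> 'f) \<Rightarrow> ('g \<Rightarrow> 'r ^ 2 ^ 2) \<Rightarrow> bool" where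
  "dihedral G T H \<pi> chibar \<rho> \<longleftrightarrow>
     (\<exists>chi. is_character G T H adic_topology chi \<and> (\<forall>h\<in>H. \<pi> (chi h) = chibar h) \<and>
        equivalent_to_Ind G H chi \<rho>)"


section \<open>The action on the residually trivial part of the image\<close>

definition residual_kernel ::
  "('g, 'x) monoid_scheme \<Rightarrow> ('r::comm_ring_1 \<Rightarrow> 'f::field) \<Rightarrow> ('g \<Rightarrow> 'f ^ 2 ^ 2) \<Rightarrow>
     ('g \<Rightarrow> 'r ^ 2 ^ 2) \<Rightarrow> ('r ^ 2 ^ 2) set" where
  "residual_kernel G \<pi> \<rho>bar \<rho> =
     kernel (GL2\<lparr>carrier := \<rho> ` carrier G\<rparr>) (GL2\<lparr>carrier := \<rho>bar ` carrier G\<rparr>) (map_matrix \<pi>)"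

definition frattini :: "nat \<Rightarrow> ('a, 'x) monoid_scheme \<Rightarrow> 'a topology \<Rightarrow> 'a set" where
  "frattini p K T =
     T closure_of
       (generate K {x [^]\<^bsub>K\<^esub> p | x. x \<in> carrier K} <#>\<^bsub>K\<^esub> derived K (carrier K))"

definition Ad :: "'f::comm_ring_1 ^ 2 ^ 2 \<Rightarrow> 'f ^ 2 ^ 2 \<Rightarrow> 'f ^ 2 ^ 2" where
  "Ad y = (\<lambda>M. y ** M ** inv\<^bsub>GL2\<^esub> y)"

definition ad_image :: "'g set \<Rightarrow> ('g \<Rightarrow> 'f::field ^ 2 ^ 2) \<Rightarrow> ('f ^ 2 ^ 2 \<Rightarrow> 'f ^ 2 ^ 2) set" where
  "ad_image H \<rho>bar = (\<lambda>h. Ad (\<rho>bar h)) ` H"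

text \<open>
  The element \<open>a\<close> of the adjoint image acts as conjugation by \<open>s y\<close>, for a preimage \<open>y\<close> of \<open>a\<close>
  in the image of \<open>H\<close>. On the residual kernel the result does not depend on the choice of \<open>y\<close>,
  since \<open>s\<close> maps scalar matrices to scalar matrices.
\<close>

definition ad_act ::
  "'g set \<Rightarrow> ('g \<Rightarrow> 'f::field ^ 2 ^ 2) \<Rightarrow> ('f ^ 2 ^ 2 \<Rightarrow> 'r::comm_ring_1 ^ 2 ^ 2) \<Rightarrow>
     ('f ^ 2 ^ 2 \<Rightarrow> 'f ^ 2 ^ 2) \<Rightarrow> 'r ^ 2 ^ 2 \<Rightarrow> 'r ^ 2 ^ 2" where
  "ad_act H \<rho>bar s a x =
     (let y = (SOME y. y \<in> \<rho>bar ` H \<and> Ad y = a) in s y ** x ** inv\<^bsub>GL2\<^esub> (s y))"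

definition topologically_isomorphic ::
  "('a, 'x) monoid_scheme \<Rightarrow> 'a topology \<Rightarrow> ('b, 'y) monoid_scheme \<Rightarrow> 'b topology \<Rightarrow> bool" where
  "topologically_isomorphic K S L T \<longleftrightarrow> (\<exists>f \<in> iso K L. homeomorphic_map S T f)"

end

theory Submission
  imports Defs
begin

text \<open>
  Some \<open>k \<in> H\<close> has \<open>chibar k \<noteq> chibar (\<sigma> k \<sigma>\<inverse>)\<close>, so the two eigenvalues of \<open>\<rho>bar k\<close> are distinct and lift by
  Hensel's lemma to eigenvalues \<open>x\<close>, \<open>y\<close> of \<open>D = s (\<rho>bar k)\<close> with \<open>x - y\<close> a unit. Let \<open>e\<close> and \<open>f\<close> be
  the corresponding complementary eigenprojections. If \<open>\<Gamma>\<close> commutes with \<open>D\<close>, then so does \<open>\<rho> ` H\<close>,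
  which is generated by \<open>\<Gamma>\<close> and the abelian group \<open>s ` \<rho>bar ` H\<close>; hence \<open>e ** \<rho> h\<close> is a multiple
  \<open>chi h\<close> of \<open>e\<close>, and \<open>\<rho>\<close> is induced from the character \<open>chi\<close>. Conversely \<open>\<rho> ` H\<close> is abelian when
  \<open>\<rho>\<close> is dihedral.

  Triviality modulo the Frattini subgroup suffices for the following reason. If \<open>e ** g ** f\<close> is zero
  modulo \<open>\<mm> k\<close> for all \<open>g \<in> \<Gamma>\<close>, then \<open>g \<mapsto> e ** g ** f\<close> modulo \<open>\<mm> (k + 1)\<close> is a continuous
  homomorphism to an elementary abelian \<open>p\<close>-group, so it kills the Frattini subgroup; conjugation
  by \<open>D\<close> multiplies it by \<open>x / y\<close> and preserves it, so it is zero. As the ring is separated,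
  \<open>e ** g ** f = 0\<close>, likewise \<open>f ** g ** e = 0\<close>, and \<open>g\<close> commutes with \<open>D\<close>.
\<close>

no_notation fps_nth (infixl \<open>$\<close> 75)

section \<open>Complete local rings\<close>

lemma type_ring_simps [simp]:
  "carrier (type_ring :: 'r::comm_ring_1 ring) = UNIV"
  "x \<otimes>\<^bsub>type_ring\<^esub> y = x * y"
  "x \<oplus>\<^bsub>type_ring\<^esub> y = x + y"
  "\<one>\<^bsub>type_ring\<^esub> = (1 :: 'r)"
  "\<zero>\<^bsub>type_ring\<^esub> = (0 :: 'r)"
  by (simp_all add: ring_of_type_algebra_def)

lemma type_ring_a_inv: "\<ominus>\<^bsub>type_ring\<^esub> x = - (x :: 'r::comm_ring_1)"
proof -
  interpret cring "type_ring :: 'r ring" by (rule cring_from_type_algebra)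
  show ?thesis by (rule minus_equality) auto
qed

lemma ideal_type_ringD:
  fixes I :: "'r::comm_ring_1 set"
  assumes "ideal I type_ring"
  shows "0 \<in> I"
    and "x \<in> I \<Longrightarrow> y \<in> I \<Longrightarrow> x + y \<in> I"
    and "x \<in> I \<Longrightarrow> - x \<in> I"
    and "x \<in> I \<Longrightarrow> r * x \<in> I"
proof -
  interpret ideal I "type_ring :: 'r ring" by fact
  show "0 \<in> I" using additive_subgroup.zero_closed[OF is_additive_subgroup] by simp
  show "x \<in> I \<Longrightarrow> y \<in> I \<Longrightarrow> x + y \<in> I" using additive_subgroup.a_closed[OF is_additive_subgroup, of x y] by simp
  show "x \<in> I \<Longrightarrow> - x \<in> I" using additive_subgroup.a_inv_closed[OF is_additive_subgroup, of x] by (simp add: type_ring_a_inv)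
  show "x \<in> I \<Longrightarrow> r * x \<in> I" using I_l_closed[of x r] by simp
qed

section \<open>The residue map and the powers of the maximal ideal\<close>

locale coefficient_ring =
  fixes p :: nat and \<alpha> :: "(nat \<Rightarrow> 'f::field) \<Rightarrow> 'r::comm_ring_1" and \<pi> :: "'r \<Rightarrow> 'f"
  assumes coeff: "coefficient_algebra p \<alpha> \<pi>"
begin

abbreviation \<mm> :: "nat \<Rightarrow> 'r set" where "\<mm> \<equiv> max_ideal_pow"

lemma pi_add [simp]: "\<pi> (x + y) = \<pi> x + \<pi> y"
  and pi_mult [simp]: "\<pi> (x * y) = \<pi> x * \<pi> y"
  and pi_1 [simp]: "\<pi> 1 = 1"
  using coeff by (auto simp: coefficient_algebra_def ring_hom_def)

lemma pi_0 [simp]: "\<pi> 0 = 0"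
  using add_left_cancel[of "\<pi> 0" "\<pi> 0" 0] pi_add[of 0 0] by (metis add.right_neutral)

lemma pi_minus [simp]: "\<pi> (- x) = - \<pi> x"
  using pi_add[of x "- x"] by (simp add: eq_neg_iff_add_eq_0 add.commute)

lemma pi_diff [simp]: "\<pi> (x - y) = \<pi> x - \<pi> y"
  using pi_add[of x "- y"] by simp

lemma pi_of_nat [simp]: "\<pi> (of_nat n) = of_nat n"
  by (induction n) auto

lemma surj_pi: "surj \<pi>"
  using coeff by (simp add: coefficient_algebra_def)

lemma max_ideal_iff: "x \<in> max_ideal \<longleftrightarrow> \<pi> x = 0"
proof -
  have "a_kernel type_ring type_ring \<pi> = max_ideal"
    using coeff by (simp add: coefficient_algebra_def)
  then show ?thesis
    by (auto simp: a_kernel_def kernel_def)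
qed

lemma ideal_max_ideal: "ideal (max_ideal :: 'r set) type_ring"
proof -
  have "\<exists>!M. maximalideal M (type_ring :: 'r ring)"
    using coeff by (simp add: coefficient_algebra_def)
  then have "maximalideal max_ideal (type_ring :: 'r ring)"
    unfolding max_ideal_def by (rule theI')
  then show ?thesis by (rule maximalideal.axioms)
qed

lemma m_0 [simp]: "\<mm> 0 = UNIV"
  by (simp add: max_ideal_pow_def ideals_set_def nat_pow_def)

lemma m_Suc: "\<mm> (Suc n) = \<mm> n \<cdot>\<^bsub>type_ring\<^esub> max_ideal"
  by (simp add: max_ideal_pow_def ideals_set_def nat_pow_def)

lemma ideal_m: "ideal (\<mm> n) type_ring"
proof -
  interpret cring "type_ring :: 'r ring" by (rule cring_from_type_algebra)
  show ?thesis
  proof (induction n)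
    case 0
    show ?case using oneideal by simp
  next
    case (Suc n)
    then show ?case unfolding m_Suc by (rule ideal_prod_is_ideal[OF _ ideal_max_ideal])
  qed
qed

lemmas m_zero [simp] = ideal_type_ringD(1)[OF ideal_m]
  and m_add = ideal_type_ringD(2)[OF ideal_m]
  and m_uminus = ideal_type_ringD(3)[OF ideal_m]
  and m_mult_left = ideal_type_ringD(4)[OF ideal_m]

lemma m_diff: "x \<in> \<mm> n \<Longrightarrow> y \<in> \<mm> n \<Longrightarrow> x - y \<in> \<mm> n"
  using m_add[of x n "- y"] m_uminus[of y n] by simp

lemma m_diff_trans: "x - y \<in> \<mm> n \<Longrightarrow> y - z \<in> \<mm> n \<Longrightarrow> x - z \<in> \<mm> n"
  using m_add[of "x - y" n "y - z"] by simp

lemma m_Suc_subset: "\<mm> (Suc n) \<subseteq> \<mm> n"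
proof -
  interpret cring "type_ring :: 'r ring" by (rule cring_from_type_algebra)
  show ?thesis
    using ideal_prod_inter[OF ideal_m ideal_max_ideal] by (auto simp: m_Suc)
qed

lemma m_mult_Suc: "x \<in> \<mm> n \<Longrightarrow> \<pi> y = 0 \<Longrightarrow> x * y \<in> \<mm> (Suc n)"
  using ideal_prod.prod[of x "\<mm> n" y max_ideal "type_ring :: 'r ring"]
  by (simp add: m_Suc max_ideal_iff)

lemma m_one_iff: "x \<in> \<mm> (Suc 0) \<longleftrightarrow> \<pi> x = 0"
proof
  interpret cring "type_ring :: 'r ring" by (rule cring_from_type_algebra)
  show "x \<in> \<mm> (Suc 0) \<Longrightarrow> \<pi> x = 0"
    using ideal_prod_inter[OF ideal_m ideal_max_ideal, of 0]
    by (auto simp: m_Suc max_ideal_iff[symmetric])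
  show "\<pi> x = 0 \<Longrightarrow> x \<in> \<mm> (Suc 0)"
    using m_mult_Suc[of 1 0 x] by simp
qed

lemma m_power: "\<pi> x = 0 \<Longrightarrow> x ^ n \<in> \<mm> n"
  by (induction n) (auto simp: mult.commute[of x] intro: m_mult_Suc)

lemma eq_0_if_in_all_m: "(\<And>n. x \<in> \<mm> n) \<Longrightarrow> x = 0"
  using coeff by (auto simp: coefficient_algebra_def adic_complete_def)

lemma m_complete:
  assumes "\<And>n. u (Suc n) - u n \<in> \<mm> n"
  shows "\<exists>l. \<forall>n. l - u n \<in> \<mm> n"
  using coeff assms by (simp add: coefficient_algebra_def adic_complete_def)

section \<open>Units and Hensel lifting\<close>

text \<open>The inverse is the geometric series in \<open>1 - x\<close>: its partial sums converge
  by completeness, and the error terms vanish because the ring is separated.\<close>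

lemma unit_if_residue_1:
  assumes "\<pi> x = 1"
  obtains y where "x * y = 1"
proof -
  define u where "u = 1 - x"
  have u: "\<pi> u = 0" using assms by (simp add: u_def)
  obtain l where l: "\<And>n. l - (\<Sum>k<n. u ^ k) \<in> \<mm> n"
    using m_complete[of "\<lambda>n. \<Sum>k<n. u ^ k"] m_power[OF u] by auto
  have "x * l - 1 \<in> \<mm> n" for n
  proof -
    have "x * (\<Sum>k<n. u ^ k) = 1 - u ^ n"
      \<comment> \<open>\<open>sum_gp_basic\<close> includes its upper bound, so it is used at
        \<open>n - 1\<close>, and the empty sum at \<open>n = 0\<close> is split off.\<close>
      using sum_gp_basic[of u "n - 1"] by (cases n) (auto simp: u_def lessThan_Suc_atMost)
    then have "x * l - 1 = x * (l - (\<Sum>k<n. u ^ k)) - u ^ n"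
      by (simp add: algebra_simps)
    then show ?thesis
      using l[of n] m_power[OF u, of n] by (auto intro: m_diff m_mult_left)
  qed
  then have "x * l - 1 = 0" by (rule eq_0_if_in_all_m)
  then show thesis using that[of l] by simp
qed

lemma unit_if_residue_nz:
  assumes "\<pi> x \<noteq> 0"
  obtains y where "x * y = 1"
proof -
  obtain z where z: "\<pi> z = inverse (\<pi> x)" using surj_pi by (metis surjD)
  then have "\<pi> (x * z) = 1" using assms by simp
  then obtain y where "x * z * y = 1" by (rule unit_if_residue_1)
  then show thesis using that[of "z * y"] by (simp add: mult.assoc)
qed

text \<open>Newton iteration from any lift \<open>x0\<close> of \<open>a\<close>, with the inverse
  \<open>c\<close> of the derivative at \<open>x0\<close> kept fixed. Each step still gains one
  power of the maximal ideal, because the derivative has the same residue at all iterates.\<close>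

lemma quadratic_root_lift:
  assumes root: "a * a - \<pi> t * a + \<pi> d = 0" and simple: "2 * a - \<pi> t \<noteq> 0"
  obtains x where "x * x - t * x + d = 0" "\<pi> x = a"
proof -
  define f where "f x = x * x - t * x + d" for x
  obtain x0 where x0: "\<pi> x0 = a" using surj_pi by (metis surjD)
  have "\<pi> (2 * x0 - t) \<noteq> 0" using simple x0 pi_of_nat[of 2] by simp
  then obtain c where c: "(2 * x0 - t) * c = 1" by (rule unit_if_residue_nz)
  define u where "u n = ((\<lambda>x. x - c * f x) ^^ n) x0" for n
  have u_Suc: "u (Suc n) = u n - c * f (u n)" for n by (simp add: u_def)
  \<comment> \<open>The exponent is \<open>Suc n\<close> because \<open>f x0\<close> is residually
    zero and so already lies in \<open>\<mm> (Suc 0)\<close>.\<close>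
  have u: "\<pi> (u n) = a \<and> f (u n) \<in> \<mm> (Suc n)" for n
  proof (induction n)
    case 0
    show ?case using root x0 by (simp add: u_def f_def m_one_iff)
  next
    case (Suc n)
    define y where "y = u n"
    have fy: "\<pi> (f y) = 0" and pi_y: "\<pi> y = a"
      using Suc root by (auto simp: f_def y_def)
    \<comment> \<open>This is the exact Taylor expansion of \<open>f\<close> at \<open>y\<close> for
      the step \<open>c * f y\<close>. The second factor is residually zero since \<open>c\<close>
      inverts the derivative modulo the maximal ideal.\<close>
    have "f (u (Suc n)) = f y * (1 - c * (2 * y - t) + c * c * f y)"
      unfolding u_Suc y_def[symmetric] by (simp add: f_def algebra_simps)
    moreover have "\<pi> (1 - c * (2 * y - t) + c * c * f y) = 0"
    proof -
      have "\<pi> c * (2 * a - \<pi> t) = 1"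
        using arg_cong[OF c, of \<pi>] pi_of_nat[of 2] x0 by (simp add: mult.commute)
      then show ?thesis using fy pi_y pi_of_nat[of 2] by simp
    qed
    ultimately have "f (u (Suc n)) \<in> \<mm> (Suc (Suc n))"
      using Suc m_mult_Suc by (simp add: y_def)
    moreover have "\<pi> (u (Suc n)) = a"
      using fy pi_y by (simp add: u_Suc y_def)
    ultimately show ?case by simp
  qed
  have "u (Suc n) - u n \<in> \<mm> n" for n
  proof -
    have "u (Suc n) - u n = - (c * f (u n))" by (simp add: u_Suc)
    then show ?thesis
      using u[of n] m_Suc_subset[of n] by (auto intro!: m_uminus m_mult_left)
  qed
  then obtain l where l: "\<And>n. l - u n \<in> \<mm> n"
    using m_complete[of u] by blast
  have "f l \<in> \<mm> n" for n
  proof -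
    have "f l = f (u n) + (l + u n - t) * (l - u n)" by (simp add: f_def algebra_simps)
    then show ?thesis
      using u[of n] m_Suc_subset[of n] l[of n] by (auto intro!: m_add m_mult_left)
  qed
  then have "f l = 0" by (rule eq_0_if_in_all_m)
  moreover have "\<pi> l = a"
    using l[of "Suc 0"] u[of "Suc 0"] by (simp add: m_one_iff)
  ultimately show thesis using that[of l] by (simp add: f_def)
qed

end

section \<open>Two-by-two matrices\<close>

lemma matrix_add_rdistrib:
  fixes A :: "'a::comm_ring_1 ^ 'n ^ 'm"
  shows "(A + B) ** C = A ** C + B ** C"
  by (simp add: vec_eq_iff matrix_matrix_mult_def sum.distrib distrib_right)

lemma matrix_diff_ldistrib:
  fixes A :: "'a::comm_ring_1 ^ 'n ^ 'm"
  shows "A ** (B - C) = A ** B - A ** C"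
  by (simp add: vec_eq_iff matrix_matrix_mult_def sum_subtractf right_diff_distrib)

lemma matrix_diff_rdistrib:
  fixes A :: "'a::comm_ring_1 ^ 'n ^ 'm"
  shows "(A - B) ** C = A ** C - B ** C"
  by (simp add: vec_eq_iff matrix_matrix_mult_def sum_subtractf left_diff_distrib)

lemmas matrix_ring_distribs =
  matrix_add_ldistrib matrix_add_rdistrib matrix_diff_ldistrib matrix_diff_rdistrib

text \<open>Scalar multiples of matrices are written \<open>mat c ** A\<close> throughout. This rule
  and the next two let \<open>mat c\<close> be handled like a scalar.\<close>

lemma mat_mult_component [simp]:
  "(mat c ** A) $ i $ j = c * (A :: 'a::comm_ring_1 ^ 'm ^ 'n) $ i $ j"
proof -
  have "(\<Sum>k\<in>UNIV. (if i = k then c else 0) * A $ k $ j) =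
      (\<Sum>k\<in>UNIV. if i = k then c * A $ k $ j else 0)"
    by (rule sum.cong) auto
  then show ?thesis by (simp add: matrix_matrix_mult_def mat_def)
qed

lemma mat_mult_commute: "A ** mat c = mat c ** (A :: 'a::comm_ring_1 ^ 'n ^ 'n)"
proof -
  have "(\<Sum>k\<in>UNIV. A $ i $ k * (if k = j then c else 0)) =
      (\<Sum>k\<in>UNIV. if k = j then c * A $ i $ k else 0)" for i j
    by (rule sum.cong) auto
  then have "(A ** mat c) $ i $ j = c * A $ i $ j" for i j
    by (simp add: matrix_matrix_mult_def mat_def)
  then show ?thesis by (simp add: vec_eq_iff)
qed

lemma mat_mult_left_commute: "A ** (mat c ** B) = mat c ** (A ** B)"
  for A :: "'a::comm_ring_1 ^ 'n ^ 'n"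
  by (simp add: matrix_mul_assoc mat_mult_commute[of A c])

lemma matrix_eq_2:
  "A = B \<longleftrightarrow> A $ 1 $ 1 = B $ 1 $ 1 \<and> A $ 1 $ 2 = B $ 1 $ 2 \<and> A $ 2 $ 1 = B $ 2 $ 1 \<and> A $ 2 $ 2 = B $ 2 $ 2"
  for A B :: "'a ^ 2 ^ 2"
proof -
  have "A = B \<longleftrightarrow> (\<forall>i j. A $ i $ j = B $ i $ j)" by (metis vec_eq_iff)
  then show ?thesis by (simp add: forall_2 conj_assoc)
qed

lemma matrix_mult_2: "(A ** B) $ i $ j = A $ i $ 1 * B $ 1 $ j + A $ i $ 2 * B $ 2 $ j"
  for A B :: "'a::comm_ring_1 ^ 2 ^ 2"
  by (simp add: matrix_matrix_mult_def sum_2)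

lemma mat_2 [simp]:
  fixes c :: "'a::zero"
  defines "M \<equiv> mat c :: 'a ^ 2 ^ 2"
  shows "M $ 1 $ 1 = c" "M $ 1 $ 2 = 0" "M $ 2 $ 1 = 0" "M $ 2 $ 2 = c"
  by (simp_all add: M_def mat_def)

lemma trace_2: "trace (A :: 'a::comm_ring_1 ^ 2 ^ 2) = A $ 1 $ 1 + A $ 2 $ 2"
  by (simp add: trace_def sum_2)

lemma invertible_if_det_unit:
  fixes A :: "'a::comm_ring_1 ^ 2 ^ 2"
  assumes "det A * c = 1"
  shows "invertible A"
proof -
  \<comment> \<open>\<open>B\<close> is \<open>c\<close> times the adjugate of
    \<open>A\<close>.\<close>
  define B :: "'a ^ 2 ^ 2" where
    "B = vector [vector [c * A $ 2 $ 2, - (c * A $ 1 $ 2)], vector [- (c * A $ 2 $ 1), c * A $ 1 $ 1]]"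
  have *: "c * (A $ 1 $ 1 * A $ 2 $ 2 - A $ 1 $ 2 * A $ 2 $ 1) = 1"
    using assms by (simp add: det_2 mult.commute)
  have "A ** B = mat 1" "B ** A = mat 1"
    unfolding matrix_eq_2 using * by (simp_all add: matrix_mult_2 B_def algebra_simps)
  then show ?thesis unfolding invertible_def by blast
qed

section \<open>The group of invertible two-by-two matrices\<close>

lemma GL2_simps [simp]:
  "carrier GL2 = {A :: 'a::comm_ring_1 ^ 2 ^ 2. invertible A}"
  "A \<otimes>\<^bsub>GL2\<^esub> B = A ** B"
  "\<one>\<^bsub>GL2\<^esub> = (mat 1 :: 'a ^ 2 ^ 2)"
  by (simp_all add: GL2_def)

lemma group_GL2: "group (GL2 :: ('a::comm_ring_1 ^ 2 ^ 2) monoid)"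
proof (rule groupI)
  fix x y :: "'a ^ 2 ^ 2"
  assume "x \<in> carrier GL2" "y \<in> carrier GL2"
  then obtain x' y' where *: "x ** x' = mat 1" "x' ** x = mat 1" "y ** y' = mat 1" "y' ** y = mat 1"
    by (auto simp: invertible_def)
  have "(x ** y) ** (y' ** x') = x ** (y ** y') ** x'" "(y' ** x') ** (x ** y) = y' ** (x' ** x) ** y"
    by (simp_all add: matrix_mul_assoc)
  then show "x \<otimes>\<^bsub>GL2\<^esub> y \<in> carrier GL2"
    using * by (auto simp: invertible_def)
next
  fix x :: "'a ^ 2 ^ 2"
  assume "x \<in> carrier GL2"
  then obtain y where "x ** y = mat 1" "y ** x = mat 1" by (auto simp: invertible_def)
  then show "\<exists>y\<in>carrier GL2. y \<otimes>\<^bsub>GL2\<^esub> x = \<one>\<^bsub>GL2\<^esub>"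
    by (auto simp: invertible_def)
qed (auto simp: matrix_mul_assoc invertible_def intro: exI[of _ "mat 1"])

interpretation GL2: group GL2
  by (rule group_GL2)

lemma GL2_inv:
  assumes "invertible (A :: 'a::comm_ring_1 ^ 2 ^ 2)"
  shows "invertible (inv\<^bsub>GL2\<^esub> A)" "A ** inv\<^bsub>GL2\<^esub> A = mat 1" "inv\<^bsub>GL2\<^esub> A ** A = mat 1"
  using GL2.inv_closed[of A] GL2.r_inv[of A] GL2.l_inv[of A] assms by simp_all

text \<open>Removes the inverse from statements about conjugation, which turns them into commutation
  relations.\<close>

lemma conj_eq_iff:
  assumes "invertible (A :: 'a::comm_ring_1 ^ 2 ^ 2)"
  shows "A ** x ** inv\<^bsub>GL2\<^esub> A = y \<longleftrightarrow> A ** x = y ** A"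
  using GL2_inv[OF assms] by (metis matrix_mul_assoc matrix_mul_rid)

section \<open>Projections onto eigenspaces\<close>

text \<open>
  If \<open>x\<close> and \<open>y\<close> are the eigenvalues of \<open>D\<close> and \<open>c\<close> is the inverse of \<open>x - y\<close>, this is the
  projection onto the eigenspace of \<open>x\<close> along that of \<open>y\<close>.
\<close>

definition eigenprojection :: "'a::comm_ring_1 ^ 2 ^ 2 \<Rightarrow> 'a \<Rightarrow> 'a \<Rightarrow> 'a ^ 2 ^ 2" where
  "eigenprojection D y c = mat c ** (D - mat y)"

text \<open>The product identities rest on Cayley-Hamilton,
  \<open>(D - mat x) ** (D - mat y) = 0\<close>. Exchanging \<open>x\<close> and \<open>y\<close>
  turns \<open>c\<close> into \<open>- c\<close>, so \<open>f\<close> is the complementary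
  projection.\<close>

lemma eigenprojection:
  fixes D :: "'a::comm_ring_1 ^ 2 ^ 2"
  assumes tr: "trace D = x + y" and dt: "det D = x * y" and c: "(x - y) * c = 1"
  defines "e \<equiv> eigenprojection D y c" and "f \<equiv> eigenprojection D x (- c)"
  shows "e + f = mat 1" "e ** D = mat x ** e" "D ** e = mat x ** e" "e ** e = e" "e ** f = 0"
    "det e = 0" "trace e = 1"
proof -
  \<comment> \<open>Trace and determinant eliminate one diagonal entry and the product of the
    off-diagonal ones; the entrywise identities below become polynomial identities.\<close>
  have D22: "D $ 2 $ 2 = x + y - D $ 1 $ 1" using tr by (simp add: trace_2 algebra_simps)
  have D12: "D $ 1 $ 2 * D $ 2 $ 1 = D $ 1 $ 1 * (x + y - D $ 1 $ 1) - x * y"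
    using dt D22 by (simp add: det_2 algebra_simps)
  have c': "c * x = 1 + c * y" using c by (simp add: algebra_simps)
  show ef: "e + f = mat 1"
    unfolding matrix_eq_2 e_def f_def eigenprojection_def using c' by (simp add: algebra_simps)
  have ch: "(D - mat y) ** (D - mat x) = 0"
    unfolding matrix_eq_2 using D12 by (simp add: matrix_mult_2 D22 algebra_simps)
  have ch': "(D - mat x) ** (D - mat y) = 0"
    unfolding matrix_eq_2 using D12 by (simp add: matrix_mult_2 D22 algebra_simps)
  have e_x: "e ** (D - mat x) = 0"
    by (simp add: e_def eigenprojection_def ch matrix_mul_assoc[symmetric])
  then show "e ** D = mat x ** e" by (simp add: matrix_ring_distribs mat_mult_commute)
  have "(D - mat x) ** e = mat c ** ((D - mat x) ** (D - mat y))"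
    unfolding e_def eigenprojection_def by (metis mat_mult_commute matrix_mul_assoc)
  then have "(D - mat x) ** e = 0" using ch' by simp
  then show "D ** e = mat x ** e" by (simp add: matrix_diff_rdistrib)
  have "e ** f = mat (- c) ** (e ** (D - mat x))"
    unfolding f_def eigenprojection_def by (metis mat_mult_commute matrix_mul_assoc)
  then show "e ** f = 0" using e_x by simp
  then show "e ** e = e" using ef by (metis add.right_neutral matrix_add_ldistrib matrix_mul_rid)
  have "det (D - mat y) = 0"
    using D12 by (simp add: det_2 D22 algebra_simps)
  moreover have "det e = c * c * det (D - mat y)"
    by (simp add: det_2 e_def eigenprojection_def algebra_simps)
  ultimately show "det e = 0" by simp
  show "trace e = 1"
    using c' by (simp add: trace_2 e_def eigenprojection_def D22 algebra_simps)
qed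

text \<open>The projection is a polynomial in \<open>D\<close>.\<close>

lemma eigenprojection_commute:
  assumes "D ** A = A ** D"
  shows "eigenprojection D y c ** A = A ** eigenprojection D y c"
proof -
  have "A ** (mat c ** (D - mat y)) = mat c ** (A ** (D - mat y))"
    by (rule mat_mult_left_commute)
  also have "A ** (D - mat y) = (D - mat y) ** A"
    by (simp add: matrix_ring_distribs assms mat_mult_commute[of A y])
  finally show ?thesis by (simp add: eigenprojection_def matrix_mul_assoc)
qed

text \<open>This is the Cayley-Hamilton theorem for \<open>e ** A\<close>, with a factor \<open>e\<close> removed.\<close>

lemma singular_sandwich:
  fixes e A :: "'a::comm_ring_1 ^ 2 ^ 2"
  assumes "det e = 0"
  shows "e ** A ** e = mat (trace (e ** A)) ** e"
proof -
  \<comment> \<open>\<open>B\<close> is the adjugate of \<open>A\<close>; its coefficient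
    \<open>det e\<close> vanishes by assumption.\<close>
  define B :: "'a ^ 2 ^ 2" where
    "B = vector [vector [A $ 2 $ 2, - A $ 1 $ 2], vector [- A $ 2 $ 1, A $ 1 $ 1]]"
  have "e ** A ** e = mat (trace (e ** A)) ** e - mat (det e) ** B"
    unfolding matrix_eq_2 by (simp add: matrix_mult_2 trace_2 det_2 B_def algebra_simps)
  then show ?thesis using assms by simp
qed

section \<open>The adic topology\<close>

context coefficient_ring
begin

lemma topspace_adic [simp]: "topspace (adic_topology :: 'r topology) = UNIV"
proof -
  have "{y. y - 0 \<in> \<mm> 0} \<in> {{y. y - x \<in> \<mm> n} |x n. True}" by blast
  then have "UNIV \<subseteq> \<Union> {{y. y - x \<in> \<mm> n} |x n. True}" by auto
  then show ?thesis
    unfolding adic_topology_def topspace_def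
    by (auto simp: topology_generated_by_topspace[unfolded topspace_def])
qed

lemma openin_adic_ball: "openin adic_topology {y. y - x \<in> \<mm> n}"
  unfolding adic_topology_def by (rule topology_generated_by_Basis) blast

text \<open>The cosets of the ideals \<open>\<mm> n\<close> generate the topology, so continuity can
  be tested by congruences modulo each \<open>\<mm> n\<close>.\<close>

lemma continuous_map_adic_iff:
  fixes f :: "'a \<Rightarrow> 'r"
  shows "continuous_map S adic_topology f \<longleftrightarrow>
     (\<forall>n. \<forall>x\<in>topspace S. \<exists>U. openin S U \<and> x \<in> U \<and> (\<forall>y\<in>U. f y - f x \<in> \<mm> n))"
    (is "?L = ?R")
proof
  assume f: "continuous_map S adic_topology f"
  show ?R
  proof (intro allI ballI)
    fix n x assume "x \<in> topspace S"
    then show "\<exists>U. openin S U \<and> x \<in> U \<and> (\<forall>y\<in>U. f y - f x \<in> \<mm> n)"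
      using openin_continuous_map_preimage[OF f openin_adic_ball[of "f x" n]]
      by (intro exI[of _ "{y \<in> topspace S. f y \<in> {z. z - f x \<in> \<mm> n}}"]) auto
  qed
next
  assume R: ?R
  show "continuous_map S adic_topology f"
    unfolding adic_topology_def
  proof (rule continuous_on_generated_topo)
    fix U assume "U \<in> {{y. y - x \<in> \<mm> n} |x n. True}"
    then obtain a n where U: "U = {y. y - a \<in> \<mm> n}" by blast
    show "openin S (f -` U \<inter> topspace S)"
    proof (subst openin_subopen, intro ballI)
      fix x assume x: "x \<in> f -` U \<inter> topspace S"
      then obtain V where V: "openin S V" "x \<in> V" "\<And>y. y \<in> V \<Longrightarrow> f y - f x \<in> \<mm> n"
        using R[rule_format, of x n] by auto
      \<comment> \<open>As in an ultrametric space, every point of a ball is a center of it.\<close>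
      have "f y - a \<in> \<mm> n" if "y \<in> V" for y
        using m_diff_trans[OF V(3)[OF that]] x by (simp add: U)
      then have "V \<subseteq> f -` U \<inter> topspace S"
        using openin_subset[OF V(1)] by (auto simp: U)
      then show "\<exists>V. openin S V \<and> x \<in> V \<and> V \<subseteq> f -` U \<inter> topspace S"
        using V by blast
    qed
  next
    have "f ` topspace S \<subseteq> topspace adic_topology" by simp
    then show "f ` topspace S \<subseteq> \<Union> {{y. y - x \<in> \<mm> n} |x n. True}"
      unfolding adic_topology_def topology_generated_by_topspace .
  qed
qed

lemma continuous_map_adicD:
  fixes f :: "'a \<Rightarrow> 'r"
  assumes "continuous_map S adic_topology f" "x \<in> topspace S"
  obtains U where "openin S U" "x \<in> U" "\<And>y. y \<in> U \<Longrightarrow> f y - f x \<in> \<mm> n"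
  using assms(1)[unfolded continuous_map_adic_iff, rule_format, OF assms(2), of n] by auto

lemma continuous_map_adic_add:
  fixes f g :: "'a \<Rightarrow> 'r"
  assumes "continuous_map S adic_topology f" "continuous_map S adic_topology g"
  shows "continuous_map S adic_topology (\<lambda>x. f x + g x)"
  unfolding continuous_map_adic_iff
proof (intro allI ballI)
  fix n x assume x: "x \<in> topspace S"
  obtain U where U: "openin S U" "x \<in> U" "\<And>y. y \<in> U \<Longrightarrow> f y - f x \<in> \<mm> n"
    using continuous_map_adicD[OF assms(1) x] by metis
  obtain V where V: "openin S V" "x \<in> V" "\<And>y. y \<in> V \<Longrightarrow> g y - g x \<in> \<mm> n"
    using continuous_map_adicD[OF assms(2) x] by metis
  have "f y + g y - (f x + g x) \<in> \<mm> n" if "y \<in> U \<inter> V" for y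
    using m_add[of "f y - f x" n "g y - g x"] U(3) V(3) that by (simp add: algebra_simps)
  then show "\<exists>U. openin S U \<and> x \<in> U \<and> (\<forall>y\<in>U. f y + g y - (f x + g x) \<in> \<mm> n)"
    using U V by (intro exI[of _ "U \<inter> V"]) auto
qed

lemma continuous_map_adic_mult:
  fixes f g :: "'a \<Rightarrow> 'r"
  assumes "continuous_map S adic_topology f" "continuous_map S adic_topology g"
  shows "continuous_map S adic_topology (\<lambda>x. f x * g x)"
  unfolding continuous_map_adic_iff
proof (intro allI ballI)
  fix n x assume x: "x \<in> topspace S"
  obtain U where U: "openin S U" "x \<in> U" "\<And>y. y \<in> U \<Longrightarrow> f y - f x \<in> \<mm> n"
    using continuous_map_adicD[OF assms(1) x] by metis
  obtain V where V: "openin S V" "x \<in> V" "\<And>y. y \<in> V \<Longrightarrow> g y - g x \<in> \<mm> n"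
    using continuous_map_adicD[OF assms(2) x] by metis
  have "f y * g y - f x * g x \<in> \<mm> n" if "y \<in> U \<inter> V" for y
  proof -
    have "f y * g y - f x * g x = f y * (g y - g x) + g x * (f y - f x)"
      by (simp add: algebra_simps)
    then show ?thesis using U(3) V(3) that by (auto intro!: m_add m_mult_left)
  qed
  then show "\<exists>U. openin S U \<and> x \<in> U \<and> (\<forall>y\<in>U. f y * g y - f x * g x \<in> \<mm> n)"
    using U V by (intro exI[of _ "U \<inter> V"]) auto
qed

lemma continuous_map_adic_const: "continuous_map S adic_topology (\<lambda>x. c :: 'r)"
  by simp

lemma continuous_map_adic_matrix_mult:
  fixes F K :: "'a \<Rightarrow> 'r ^ 2 ^ 2"
  assumes "\<And>i j. continuous_map S adic_topology (\<lambda>x. F x $ i $ j)"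
    and "\<And>i j. continuous_map S adic_topology (\<lambda>x. K x $ i $ j)"
  shows "continuous_map S adic_topology (\<lambda>x. (F x ** K x) $ i $ j)"
  unfolding matrix_mult_2 by (intro continuous_map_adic_add continuous_map_adic_mult assms)

text \<open>An open subgroup is closed: its complement is a union of cosets.\<close>

lemma closedin_m: "closedin adic_topology (\<mm> n)"
proof -
  have "openin adic_topology (- \<mm> n)"
  proof (subst openin_subopen, intro ballI)
    fix x assume x: "x \<in> - \<mm> n"
    have "{y. y - x \<in> \<mm> n} \<subseteq> - \<mm> n"
    proof
      fix y assume "y \<in> {y. y - x \<in> \<mm> n}"
      then show "y \<in> - \<mm> n" using x m_diff[of y n "y - x"] by auto
    qed
    then show "\<exists>T. openin adic_topology T \<and> x \<in> T \<and> T \<subseteq> - \<mm> n"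
      using openin_adic_ball[of x n] by (intro exI[of _ "{y. y - x \<in> \<mm> n}"]) auto
  qed
  then show ?thesis by (simp add: closedin_def Compl_eq_Diff_UNIV)
qed

section \<open>Continuity of matrix-valued maps\<close>

lemma topspace_GL2_topology [simp]:
  "topspace (GL2_topology (adic_topology :: 'r topology)) = carrier GL2"
  by (simp add: GL2_topology_def topspace_pullback_topology)

text \<open>The universal properties of the pullback and product topologies reduce continuity to the
  four entries.\<close>

lemma continuous_map_GL2_iff:
  "continuous_map S (GL2_topology adic_topology) F \<longleftrightarrow>
     F \<in> topspace S \<rightarrow> carrier GL2 \<and> (\<forall>i j. continuous_map S adic_topology (\<lambda>x. F x $ i $ j))"
  for F :: "'a \<Rightarrow> 'r ^ 2 ^ 2"
proof (intro iffI conjI allI)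
  assume F: "continuous_map S (GL2_topology adic_topology) F"
  then show "F \<in> topspace S \<rightarrow> carrier GL2"
    using continuous_map_funspace[OF F] by simp
  fix i j :: 2
  have "continuous_map (product_topology (\<lambda>_. adic_topology) UNIV) adic_topology (\<lambda>x. x (i, j))"
    by (rule continuous_map_product_projection) simp
  from continuous_map_pullback[OF this, of "carrier GL2" "\<lambda>A (i, j). A $ i $ j"]
  have "continuous_map (GL2_topology adic_topology) adic_topology (\<lambda>A :: 'r ^ 2 ^ 2. A $ i $ j)"
    by (simp add: GL2_topology_def comp_def)
  from continuous_map_compose[OF F this]
  show "continuous_map S adic_topology (\<lambda>x. F x $ i $ j)" by (simp add: comp_def)
next
  assume F: "F \<in> topspace S \<rightarrow> carrier GL2 \<and> (\<forall>i j. continuous_map S adic_topology (\<lambda>x. F x $ i $ j))"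
  show "continuous_map S (GL2_topology adic_topology) F"
    unfolding GL2_topology_def
  proof (rule continuous_map_pullback')
    show "continuous_map S (product_topology (\<lambda>_. adic_topology) UNIV) ((\<lambda>A (i, j). A $ i $ j) \<circ> F)"
      using F by (auto simp: continuous_map_componentwise_UNIV comp_def)
    show "topspace S \<subseteq> F -` carrier GL2" using F by auto
  qed
qed

lemma continuous_map_GL2_mult:
  fixes F K :: "'a \<Rightarrow> 'r ^ 2 ^ 2"
  assumes "continuous_map S (GL2_topology adic_topology) F"
    and "continuous_map S (GL2_topology adic_topology) K"
  shows "continuous_map S (GL2_topology adic_topology) (\<lambda>x. F x ** K x)"
proof -
  have "F x ** K x \<in> carrier GL2" if "x \<in> topspace S" for x
    using assms that GL2.m_closed[of "F x" "K x"] unfolding continuous_map_GL2_iff by auto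
  then show ?thesis
    using assms continuous_map_adic_matrix_mult[of S F K] unfolding continuous_map_GL2_iff by auto
qed

text \<open>The residue of an entry depends only on its class modulo \<open>\<mm> 1\<close>, so
  reduction is locally constant. This makes the composite of reduction with the splitting continuous
  later on.\<close>

lemma continuous_map_residue:
  fixes F :: "'a \<Rightarrow> 'r ^ 2 ^ 2"
  assumes "continuous_map S (GL2_topology adic_topology) F"
  shows "continuous_map S (discrete_topology UNIV) (\<lambda>x. map_matrix \<pi> (F x))"
proof -
  have "openin S {x \<in> topspace S. map_matrix \<pi> (F x) \<in> W}" for W
  proof (subst openin_subopen, intro ballI)
    fix x assume x: "x \<in> {x \<in> topspace S. map_matrix \<pi> (F x) \<in> W}"
    have F: "continuous_map S adic_topology (\<lambda>x. F x $ i $ j)" for i j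
      using assms unfolding continuous_map_GL2_iff by simp
    have "\<exists>U. openin S U \<and> x \<in> U \<and> (\<forall>y\<in>U. F y $ i $ j - F x $ i $ j \<in> \<mm> (Suc 0))" for i j
      using continuous_map_adicD[OF F, of x i j "Suc 0"] x by (metis (lifting) mem_Collect_eq)
    then obtain U where U: "\<And>i j. openin S (U i j)" "\<And>i j. x \<in> U i j"
        "\<And>i j y. y \<in> U i j \<Longrightarrow> F y $ i $ j - F x $ i $ j \<in> \<mm> (Suc 0)"
      by metis
    define V where "V = U 1 1 \<inter> U 1 2 \<inter> U 2 1 \<inter> U 2 2"
    have V: "openin S V" "x \<in> V"
      unfolding V_def using U(1,2) by (simp_all add: openin_Int)
    have "map_matrix \<pi> (F y) = map_matrix \<pi> (F x)" if "y \<in> V" for y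
      using that U(3)[of y] by (simp add: V_def m_one_iff matrix_eq_2)
    then have "V \<subseteq> {x \<in> topspace S. map_matrix \<pi> (F x) \<in> W}"
      using openin_subset[OF V(1)] x by (intro subsetI) (simp add: subset_iff)
    then show "\<exists>T. openin S T \<and> x \<in> T \<and> T \<subseteq> {x \<in> topspace S. map_matrix \<pi> (F x) \<in> W}"
      using V by blast
  qed
  then show ?thesis unfolding continuous_map_def by simp
qed

end

section \<open>Congruences of matrices and the Frattini subgroup\<close>

context coefficient_ring
begin

lemma map_matrix_mult: "map_matrix \<pi> (A ** B) = map_matrix \<pi> A ** map_matrix \<pi> B"
  for A B :: "'r ^ 2 ^ 2"
  unfolding matrix_eq_2 by (simp add: matrix_mult_2)

lemma map_matrix_mat [simp]: "map_matrix \<pi> (mat c :: 'r ^ 2 ^ 2) = mat (\<pi> c)"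
  unfolding matrix_eq_2 by simp

lemma map_matrix_diff: "map_matrix \<pi> (A - B) = map_matrix \<pi> A - map_matrix \<pi> B"
  for A B :: "'r ^ 2 ^ 2"
  unfolding matrix_eq_2 by simp

lemma trace_map_matrix: "trace (map_matrix \<pi> A) = \<pi> (trace A)" for A :: "'r ^ 2 ^ 2"
  by (simp add: trace_2)

lemma det_map_matrix: "det (map_matrix \<pi> A) = \<pi> (det A)" for A :: "'r ^ 2 ^ 2"
  by (simp add: det_2)

definition m_mat :: "nat \<Rightarrow> ('r ^ 2 ^ 2) set" where
  "m_mat n = {A. \<forall>i j. A $ i $ j \<in> \<mm> n}"

lemma m_mat_0 [simp]: "0 \<in> m_mat n"
  by (simp add: m_mat_def)

lemma m_mat_add: "A \<in> m_mat n \<Longrightarrow> B \<in> m_mat n \<Longrightarrow> A + B \<in> m_mat n"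
  by (simp add: m_mat_def m_add)

lemma m_mat_diff: "A \<in> m_mat n \<Longrightarrow> B \<in> m_mat n \<Longrightarrow> A - B \<in> m_mat n"
  by (simp add: m_mat_def m_diff)

lemma m_mat_mult_left: "B \<in> m_mat n \<Longrightarrow> A ** B \<in> m_mat n"
  by (auto simp: m_mat_def matrix_mult_2 intro!: m_add m_mult_left)

lemma m_mat_mult_Suc:
  assumes "A \<in> m_mat n" "map_matrix \<pi> B = 0"
  shows "A ** B \<in> m_mat (Suc n)" "B ** A \<in> m_mat (Suc n)"
proof -
  have B: "\<pi> (B $ i $ j) = 0" for i j
    using assms(2) by (metis nth_map_matrix zero_index)
  show "A ** B \<in> m_mat (Suc n)"
    using assms(1) B by (auto simp: m_mat_def matrix_mult_2 intro!: m_add m_mult_Suc)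
  show "B ** A \<in> m_mat (Suc n)"
    using assms(1) B
    by (auto simp: m_mat_def matrix_mult_2 mult.commute[of "B $ _ $ _"] intro!: m_add m_mult_Suc)
qed

lemma eq_0_if_in_all_m_mat:
  assumes "\<And>n. A \<in> m_mat n"
  shows "A = 0"
proof -
  have "A $ i $ j = 0" for i j
    using assms by (intro eq_0_if_in_all_m) (simp add: m_mat_def)
  then show ?thesis by (simp add: vec_eq_iff)
qed

text \<open>
  Inserting \<open>e + f\<close> between \<open>x\<close> and \<open>y\<close> leaves error terms with one factor in \<open>m_mat k\<close> and
  one residually zero factor, so \<open>x \<mapsto> e ** x ** f\<close> is additive modulo \<open>m_mat (Suc k)\<close>.
\<close>

lemma offdiag_mult:
  fixes e f x y :: "'r ^ 2 ^ 2"
  assumes ef: "e + f = mat 1" "e ** f = 0"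
    and x: "map_matrix \<pi> x = mat 1" "e ** x ** f \<in> m_mat k"
    and y: "map_matrix \<pi> y = mat 1" "e ** y ** f \<in> m_mat k"
  shows "e ** (x ** y) ** f - (e ** x ** f + e ** y ** f) \<in> m_mat (Suc k)"
proof -
  have e: "e ** e = e" using ef by (metis add.right_neutral matrix_add_ldistrib matrix_mul_rid)
  have f: "f ** f = f" using ef by (metis add.left_neutral matrix_add_rdistrib matrix_mul_lid)
  \<comment> \<open>\<open>a\<close> and \<open>b\<close> are the residually zero factors of the two
    error terms.\<close>
  define a where "a = e ** (x - mat 1)"
  define b where "b = (y - mat 1) ** f"
  have a: "map_matrix \<pi> a = 0" and b: "map_matrix \<pi> b = 0"
    using x y by (simp_all add: a_def b_def map_matrix_mult map_matrix_diff)
  have "e ** (x ** y) ** f = e ** x ** (e + f) ** y ** f"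
    by (simp add: ef matrix_mul_assoc)
  also have "\<dots> = e ** x ** (e ** y ** f) + (e ** x ** f) ** (y ** f)"
    by (simp add: matrix_ring_distribs matrix_mul_assoc)
  finally have 1: "e ** (x ** y) ** f = e ** x ** (e ** y ** f) + (e ** x ** f) ** (y ** f)" .
  have 2: "a ** (e ** y ** f) = e ** x ** (e ** y ** f) - e ** y ** f"
    by (simp add: a_def matrix_ring_distribs matrix_mul_assoc e)
  have 3: "(e ** x ** f) ** b = (e ** x ** f) ** (y ** f) - e ** x ** f"
    using f by (simp add: b_def matrix_ring_distribs matrix_mul_assoc[symmetric])
  have "e ** (x ** y) ** f - (e ** x ** f + e ** y ** f) = a ** (e ** y ** f) + (e ** x ** f) ** b"
    unfolding 1 2 3 by simp
  then show ?thesis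
    using m_mat_mult_Suc(2)[OF y(2) a] m_mat_mult_Suc(1)[OF x(2) b] by (simp add: m_mat_add)
qed

end

text \<open>The Frattini argument is carried out for any group of residually trivial matrices and is
  instantiated later with the residual kernel.\<close>

locale residually_trivial_group = coefficient_ring p \<alpha> \<pi>
  for p :: nat and \<alpha> :: "(nat \<Rightarrow> 'f::field) \<Rightarrow> 'r::comm_ring_1" and \<pi> +
  fixes \<Gamma> :: "('r ^ 2 ^ 2) set"
  assumes char_p: "of_nat p = (0 :: 'f)"
    and subgroup_Gamma: "subgroup \<Gamma> GL2"
    and Gamma_residue: "x \<in> \<Gamma> \<Longrightarrow> map_matrix \<pi> x = mat 1"
begin

lemma group_Gamma: "group (GL2\<lparr>carrier := \<Gamma>\<rparr>)"
  using subgroup.subgroup_is_group[OF subgroup_Gamma group_GL2] .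

lemma Gamma_mult: "x \<in> \<Gamma> \<Longrightarrow> y \<in> \<Gamma> \<Longrightarrow> x ** y \<in> \<Gamma>"
  using subgroup.m_closed[OF subgroup_Gamma, of x y] by simp

lemma Gamma_one: "mat 1 \<in> \<Gamma>"
  using subgroup.one_closed[OF subgroup_Gamma] by simp

lemma Gamma_invertible: "x \<in> \<Gamma> \<Longrightarrow> invertible x"
  using subgroup.mem_carrier[OF subgroup_Gamma, of x] by simp

lemma Gamma_inv: "x \<in> \<Gamma> \<Longrightarrow> inv\<^bsub>GL2\<^esub> x \<in> \<Gamma>"
  using subgroup.m_inv_closed[OF subgroup_Gamma, of x] by simp

section \<open>The Frattini subgroup and off-diagonal parts\<close>

abbreviation (input) \<Phi> :: "('r ^ 2 ^ 2) set" where
  "\<Phi> \<equiv> frattini p (GL2\<lparr>carrier := \<Gamma>\<rparr>) (subtopology (GL2_topology adic_topology) \<Gamma>)"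

lemma frattini_subset: "\<Phi> \<subseteq> \<Gamma>"
  unfolding frattini_def using closure_of_subset_topspace[of "subtopology (GL2_topology adic_topology) \<Gamma>"]
  by auto

text \<open>A subgroup containing the generators contains both generated subgroups and their product
  set; being closed, it contains the closure.\<close>

lemma frattini_least:
  assumes N: "subgroup N (GL2\<lparr>carrier := \<Gamma>\<rparr>)"
    and closed: "closedin (subtopology (GL2_topology adic_topology) \<Gamma>) N"
    and pow: "\<And>x. x \<in> \<Gamma> \<Longrightarrow> x [^]\<^bsub>GL2\<lparr>carrier := \<Gamma>\<rparr>\<^esub> p \<in> N"
    and comm: "\<And>x y. x \<in> \<Gamma> \<Longrightarrow> y \<in> \<Gamma> \<Longrightarrow> x ** y ** inv\<^bsub>GL2\<^esub> x ** inv\<^bsub>GL2\<^esub> y \<in> N"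
  shows "\<Phi> \<subseteq> N"
proof -
  interpret K: group "GL2\<lparr>carrier := \<Gamma>\<rparr>" by (rule group_Gamma)
  have 1: "generate (GL2\<lparr>carrier := \<Gamma>\<rparr>) {x [^]\<^bsub>GL2\<lparr>carrier := \<Gamma>\<rparr>\<^esub> p | x. x \<in> \<Gamma>} \<subseteq> N"
    using pow by (intro K.generate_subgroup_incl[OF _ N]) auto
  have "derived_set (GL2\<lparr>carrier := \<Gamma>\<rparr>) \<Gamma> \<subseteq> N"
    using comm by (auto simp: GL2.m_inv_consistent[OF subgroup_Gamma])
  then have 2: "derived (GL2\<lparr>carrier := \<Gamma>\<rparr>) \<Gamma> \<subseteq> N"
    unfolding derived_def by (intro K.generate_subgroup_incl[OF _ N])
  have "generate (GL2\<lparr>carrier := \<Gamma>\<rparr>) {x [^]\<^bsub>GL2\<lparr>carrier := \<Gamma>\<rparr>\<^esub> p | x. x \<in> \<Gamma>}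
      <#>\<^bsub>GL2\<lparr>carrier := \<Gamma>\<rparr>\<^esub> derived (GL2\<lparr>carrier := \<Gamma>\<rparr>) \<Gamma> \<subseteq> N"
    using 1 2 subgroup.m_closed[OF N] unfolding set_mult_def by blast
  then show ?thesis
    unfolding frattini_def using closed by (simp add: closure_of_minimal)
qed

text \<open>Guarantees that a coset of \<open>\<Phi>\<close> contains its representative, which is
  how triviality of the action on cosets is exploited.\<close>

lemma one_in_frattini: "mat 1 \<in> \<Phi>"
proof -
  let ?A = "generate (GL2\<lparr>carrier := \<Gamma>\<rparr>) {x [^]\<^bsub>GL2\<lparr>carrier := \<Gamma>\<rparr>\<^esub> p | x. x \<in> \<Gamma>}"
  let ?B = "derived (GL2\<lparr>carrier := \<Gamma>\<rparr>) \<Gamma>"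
  have "\<one>\<^bsub>GL2\<lparr>carrier := \<Gamma>\<rparr>\<^esub> \<in> ?A" "\<one>\<^bsub>GL2\<lparr>carrier := \<Gamma>\<rparr>\<^esub> \<in> ?B"
    unfolding derived_def by (rule generate.one)+
  then have "\<one>\<^bsub>GL2\<lparr>carrier := \<Gamma>\<rparr>\<^esub> \<otimes>\<^bsub>GL2\<lparr>carrier := \<Gamma>\<rparr>\<^esub> \<one>\<^bsub>GL2\<lparr>carrier := \<Gamma>\<rparr>\<^esub> \<in> ?A <#>\<^bsub>GL2\<lparr>carrier := \<Gamma>\<rparr>\<^esub> ?B"
    unfolding set_mult_def by blast
  then have "mat 1 \<in> ?A <#>\<^bsub>GL2\<lparr>carrier := \<Gamma>\<rparr>\<^esub> ?B" by simp
  moreover have "mat 1 \<in> topspace (subtopology (GL2_topology adic_topology) \<Gamma>)"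
    using Gamma_one Gamma_invertible by simp
  ultimately show ?thesis
    using closure_of_subset_Int[of "subtopology (GL2_topology adic_topology) \<Gamma>"
        "?A <#>\<^bsub>GL2\<lparr>carrier := \<Gamma>\<rparr>\<^esub> ?B"]
    by (auto simp: frattini_def)
qed

text \<open>By \<open>offdiag_mult\<close>, \<open>b\<close> is a homomorphism modulo
  \<open>m_mat (Suc k)\<close>. Its target is abelian and its values are killed by \<open>p\<close>,
  so its closed kernel \<open>N\<close> satisfies the conditions of
  \<open>frattini_least\<close>.\<close>

lemma offdiag_frattini:
  assumes ef: "e + f = mat 1" "e ** f = 0"
    and k: "\<And>x. x \<in> \<Gamma> \<Longrightarrow> e ** x ** f \<in> m_mat k"
    and z: "z \<in> \<Phi>"
  shows "e ** z ** f \<in> m_mat (Suc k)"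
proof -
  interpret K: group "GL2\<lparr>carrier := \<Gamma>\<rparr>" by (rule group_Gamma)
  define b where "b x = e ** x ** f" for x
  have b_mult: "b (x ** y) - (b x + b y) \<in> m_mat (Suc k)" if "x \<in> \<Gamma>" "y \<in> \<Gamma>" for x y
    unfolding b_def using offdiag_mult[OF ef] that k Gamma_residue by simp
  have b_one: "b (mat 1) = 0" using ef by (simp add: b_def)
  define N where "N = {x \<in> \<Gamma>. b x \<in> m_mat (Suc k)}"
  have b_inv: "b x + b (inv\<^bsub>GL2\<^esub> x) \<in> m_mat (Suc k)" if "x \<in> \<Gamma>" for x
    using m_mat_diff[OF m_mat_0 b_mult[OF that Gamma_inv[OF that]]] GL2_inv(2)[OF Gamma_invertible[OF that]] b_one
    by (simp add: add.commute)
  have N_mult: "x ** y \<in> N" if "x \<in> N" "y \<in> N" for x y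
    using m_mat_add[OF b_mult[of x y] m_mat_add[of "b x" "Suc k" "b y"]] that Gamma_mult
    by (simp add: N_def)
  have N: "subgroup N (GL2\<lparr>carrier := \<Gamma>\<rparr>)"
  proof (rule K.subgroupI)
    show "N \<noteq> {}" using Gamma_one b_one by (auto simp: N_def)
    fix x assume x: "x \<in> N"
    then have "b (inv\<^bsub>GL2\<^esub> x) \<in> m_mat (Suc k)"
      using m_mat_diff[OF b_inv[of x], of "b x"] by (simp add: N_def)
    then show "inv\<^bsub>GL2\<lparr>carrier := \<Gamma>\<rparr>\<^esub> x \<in> N"
      using x Gamma_inv by (simp add: N_def GL2.m_inv_consistent[OF subgroup_Gamma])
    fix y assume "y \<in> N"
    then show "x \<otimes>\<^bsub>GL2\<lparr>carrier := \<Gamma>\<rparr>\<^esub> y \<in> N" using x N_mult by simp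
  qed (auto simp: N_def)
  have closed: "closedin (subtopology (GL2_topology adic_topology) \<Gamma>) N"
  proof -
    let ?S = "subtopology (GL2_topology adic_topology) \<Gamma>"
    have "continuous_map ?S (GL2_topology adic_topology) (\<lambda>x. x)"
      by (simp add: continuous_map_from_subtopology)
    then have "continuous_map ?S adic_topology (\<lambda>x. b x $ i $ j)" for i j
      unfolding b_def continuous_map_GL2_iff
      by (intro continuous_map_adic_matrix_mult continuous_map_adic_const) simp
    then have *: "closedin ?S {x \<in> topspace ?S. b x $ i $ j \<in> \<mm> (Suc k)}" for i j
      using closedin_continuous_map_preimage closedin_m by blast
    have "N = {x \<in> topspace ?S. b x $ 1 $ 1 \<in> \<mm> (Suc k)} \<inter> {x \<in> topspace ?S. b x $ 1 $ 2 \<in> \<mm> (Suc k)}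
        \<inter> {x \<in> topspace ?S. b x $ 2 $ 1 \<in> \<mm> (Suc k)} \<inter> {x \<in> topspace ?S. b x $ 2 $ 2 \<in> \<mm> (Suc k)}"
      by (auto simp: N_def m_mat_def forall_2 Gamma_invertible)
    then show ?thesis using * by (simp add: closedin_Int)
  qed
  have pow: "x [^]\<^bsub>GL2\<lparr>carrier := \<Gamma>\<rparr>\<^esub> p \<in> N" if x: "x \<in> \<Gamma>" for x
  proof -
    \<comment> \<open>Modulo \<open>m_mat (Suc k)\<close>, an \<open>n\<close>-th power is sent to
      \<open>n\<close> times the value; the case \<open>n = p\<close> is the one wanted.\<close>
    have "x [^]\<^bsub>GL2\<lparr>carrier := \<Gamma>\<rparr>\<^esub> n \<in> \<Gamma> \<and>
        b (x [^]\<^bsub>GL2\<lparr>carrier := \<Gamma>\<rparr>\<^esub> n) - mat (of_nat n) ** b x \<in> m_mat (Suc k)" for n :: nat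
    proof (induction n)
      case 0
      then show ?case using Gamma_one b_one by simp
    next
      case (Suc n)
      define y where "y = x [^]\<^bsub>GL2\<lparr>carrier := \<Gamma>\<rparr>\<^esub> n"
      have y: "y \<in> \<Gamma>" "b y - mat (of_nat n) ** b x \<in> m_mat (Suc k)"
        using Suc by (simp_all add: y_def)
      have "mat (of_nat (Suc n)) ** b x = mat (of_nat n) ** b x + b x"
        unfolding matrix_eq_2 by (simp add: algebra_simps)
      then have "b (y ** x) - mat (of_nat (Suc n)) ** b x =
          (b (y ** x) - (b y + b x)) + (b y - mat (of_nat n) ** b x)"
        by simp
      then have "b (y ** x) - mat (of_nat (Suc n)) ** b x \<in> m_mat (Suc k)"
        using m_mat_add[OF b_mult[OF y(1) x] y(2)] by (simp only:)
      then show ?case using Gamma_mult[OF y(1) x] by (simp add: y_def)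
    qed
    from this[of p] have *: "x [^]\<^bsub>GL2\<lparr>carrier := \<Gamma>\<rparr>\<^esub> p \<in> \<Gamma>"
      "b (x [^]\<^bsub>GL2\<lparr>carrier := \<Gamma>\<rparr>\<^esub> p) - mat (of_nat p) ** b x \<in> m_mat (Suc k)" by auto
    \<comment> \<open>\<open>p\<close> is residually zero, so multiplying by it raises the power of
      the maximal ideal by one.\<close>
    have "mat (of_nat p) ** b x \<in> m_mat (Suc k)"
      using k[OF x] by (intro m_mat_mult_Suc) (simp_all add: b_def char_p)
    from m_mat_add[OF *(2) this] *(1) show ?thesis by (simp add: N_def)
  qed
  have comm: "x ** y ** inv\<^bsub>GL2\<^esub> x ** inv\<^bsub>GL2\<^esub> y \<in> N" if "x \<in> \<Gamma>" "y \<in> \<Gamma>" for x y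
  proof -
    let ?x' = "inv\<^bsub>GL2\<^esub> x" and ?y' = "inv\<^bsub>GL2\<^esub> y"
    have G: "?x' \<in> \<Gamma>" "?y' \<in> \<Gamma>" "x ** y \<in> \<Gamma>" "x ** y ** ?x' \<in> \<Gamma>" "x ** y ** ?x' ** ?y' \<in> \<Gamma>"
      using that by (auto intro!: Gamma_mult Gamma_inv)
    \<comment> \<open>A telescoping sum: three errors of additivity, then the values at
      \<open>x\<close> and \<open>y\<close> cancelling those at their inverses up to
      \<open>m_mat (Suc k)\<close>.\<close>
    have "b (x ** y ** ?x' ** ?y') =
        (b (x ** y ** ?x' ** ?y') - (b (x ** y ** ?x') + b ?y')) +
        (b (x ** y ** ?x') - (b (x ** y) + b ?x')) + (b (x ** y) - (b x + b y)) +
        (b x + b ?x') + (b y + b ?y')"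
      by simp
    moreover have "\<dots> \<in> m_mat (Suc k)"
      using that G by (intro m_mat_add b_mult b_inv)
    ultimately show ?thesis using G by (simp add: N_def)
  qed
  show ?thesis
    using frattini_least[OF N closed pow comm] z by (auto simp: N_def b_def)
qed

text \<open>Induction on \<open>k\<close> pushes the off-diagonal part into every power of the
  maximal ideal: conjugation by \<open>D\<close> scales it by a factor \<open>x / y\<close> but
  changes it only by a contribution of \<open>z\<close>, which \<open>offdiag_frattini\<close>
  controls.\<close>

lemma offdiag_eq_0:
  assumes ef: "e + f = mat 1" "e ** f = 0"
    and D: "e ** D = mat x ** e" "D ** f = mat y ** f" "(x - y) * c = 1"
    and conj: "\<And>g. g \<in> \<Gamma> \<Longrightarrow> \<exists>z\<in>\<Phi>. D ** g = z ** g ** D"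
    and g: "g \<in> \<Gamma>"
  shows "e ** g ** f = 0"
proof -
  have "\<forall>g\<in>\<Gamma>. e ** g ** f \<in> m_mat k" for k
  proof (induction k)
    case 0
    then show ?case by (simp add: m_mat_def)
  next
    case (Suc k)
    show ?case
    proof
      fix g assume g: "g \<in> \<Gamma>"
      obtain z where z: "z \<in> \<Phi>" "D ** g = z ** g ** D" using conj[OF g] by blast
      have zG: "z \<in> \<Gamma>" using z frattini_subset by blast
      have 1: "e ** (z ** g) ** f - (e ** z ** f + e ** g ** f) \<in> m_mat (Suc k)"
        using Suc zG g Gamma_residue by (intro offdiag_mult[OF ef]) auto
      have 2: "e ** z ** f \<in> m_mat (Suc k)"
        using offdiag_frattini[OF ef _ z(1)] Suc by blast
      have 3: "e ** (z ** g) ** f - e ** g ** f \<in> m_mat (Suc k)"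
        using m_mat_add[OF 1 2] by (simp add: algebra_simps)
      \<comment> \<open>The matrix \<open>e ** D ** g ** f\<close> is evaluated twice:
        \<open>e\<close> absorbs \<open>D\<close> with eigenvalue \<open>x\<close>, or
        \<open>D\<close> is moved past \<open>g\<close> and \<open>f\<close> absorbs it with
        eigenvalue \<open>y\<close>.\<close>
      have "e ** D ** g ** f = mat x ** (e ** g ** f)"
        unfolding D by (simp add: matrix_mul_assoc)
      moreover have "e ** (D ** g) ** f = mat y ** (e ** (z ** g) ** f)"
      proof -
        have "e ** (z ** g ** D) ** f = e ** (z ** g) ** (D ** f)"
          by (simp add: matrix_mul_assoc)
        then show ?thesis unfolding z D by (metis mat_mult_commute matrix_mul_assoc)
      qed
      ultimately have "mat x ** (e ** g ** f) = mat y ** (e ** (z ** g) ** f)"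
        by (simp add: matrix_mul_assoc)
      \<comment> \<open>The right side lies in \<open>m_mat (Suc k)\<close> by \<open>3\<close>, and
        multiplication by \<open>c\<close> cancels \<open>x - y\<close>.\<close>
      then have "mat (x - y) ** (e ** g ** f) = mat y ** (e ** (z ** g) ** f - e ** g ** f)"
        unfolding matrix_eq_2 by (simp add: algebra_simps)
      then have "mat c ** (mat (x - y) ** (e ** g ** f)) \<in> m_mat (Suc k)"
        using m_mat_mult_left[OF m_mat_mult_left[OF 3]] by simp
      moreover have "mat c ** (mat (x - y) ** (e ** g ** f)) = mat 1 ** (e ** g ** f)"
        unfolding matrix_eq_2 mat_mult_component using D(3) by (simp add: mult.assoc[symmetric] mult.commute[of c])
      ultimately show "e ** g ** f \<in> m_mat (Suc k)" by simp
    qed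
  qed
  then show ?thesis using g by (intro eq_0_if_in_all_m_mat) blast
qed

text \<open>Once both off-diagonal parts vanish, \<open>g\<close> commutes with \<open>e\<close> and
  \<open>f\<close>, hence with \<open>D\<close>, which is a combination of the two.\<close>

lemma commute_if_trivial_mod_frattini:
  assumes D: "trace D = x + y" "det D = x * y" "(x - y) * c = 1"
    and conj: "\<And>g. g \<in> \<Gamma> \<Longrightarrow> \<exists>z\<in>\<Phi>. D ** g = z ** g ** D"
    and g: "g \<in> \<Gamma>"
  shows "D ** g = g ** D"
proof -
  \<comment> \<open>With the eigenvalues exchanged, the roles of \<open>e\<close> and
    \<open>f\<close> are exchanged as well.\<close>
  have D': "trace D = y + x" "det D = y * x" "(y - x) * (- c) = 1"
    using D by (simp_all add: algebra_simps)
  define e where "e = eigenprojection D y c"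
  define f where "f = eigenprojection D x (- c)"
  note e = eigenprojection[OF D, folded e_def f_def]
  note f = eigenprojection[OF D', simplified, folded e_def f_def]
  have egf: "e ** g ** f = 0" "f ** g ** e = 0"
    using offdiag_eq_0[OF e(1,5) e(2) f(3) D(3) conj g] offdiag_eq_0[OF f(1,5) f(2) e(3) D'(3) conj g]
    by simp_all
  \<comment> \<open>The spectral decomposition of \<open>D\<close>.\<close>
  have De: "D = mat x ** e + mat y ** f"
    using e(1,3) f(3) by (metis matrix_add_ldistrib matrix_mul_rid)
  have "e ** g = e ** g ** (e + f)" "g ** e = (e + f) ** g ** e"
    by (simp_all add: e(1))
  then have eg: "e ** g = g ** e"
    using egf by (simp add: matrix_ring_distribs)
  have "f ** g = f ** g ** (e + f)" "g ** f = (e + f) ** g ** f"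
    by (simp_all add: e(1))
  then have fg: "f ** g = g ** f"
    using egf by (simp add: matrix_ring_distribs)
  show ?thesis
    unfolding De using eg fg
    by (simp add: matrix_ring_distribs matrix_mul_assoc mat_mult_commute) (simp add: matrix_mul_assoc[symmetric])
qed

end

section \<open>Representations induced from a subgroup of index two\<close>

definition diag2 :: "'a::comm_ring_1 \<Rightarrow> 'a \<Rightarrow> 'a ^ 2 ^ 2" where
  "diag2 a b = vector [vector [a, 0], vector [0, b]]"

lemma diag2_nth [simp]:
  "diag2 a b $ 1 $ 1 = a" "diag2 a b $ 1 $ 2 = 0" "diag2 a b $ 2 $ 1 = 0" "diag2 a b $ 2 $ 2 = b"
  by (simp_all add: diag2_def)

lemma diag2_mult: "diag2 a b ** diag2 c d = diag2 (a * c) (b * d)"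
  unfolding matrix_eq_2 by (simp add: matrix_mult_2)

lemma similar_trace_det:
  fixes P A B :: "'a::comm_ring_1 ^ 2 ^ 2"
  assumes "invertible P" "P ** A = B ** P"
  shows "trace A = trace B" "det A = det B"
proof -
  obtain Q where Q: "P ** Q = mat 1" "Q ** P = mat 1" using assms(1) by (auto simp: invertible_def)
  have A: "A = Q ** (B ** P)" using assms(2) Q by (metis matrix_mul_assoc matrix_mul_lid)
  have "trace A = trace (B ** P ** Q)" unfolding A by (rule trace_mul_sym)
  then show "trace A = trace B" using Q by (metis matrix_mul_assoc matrix_mul_rid)
  have "det Q * det P = 1" using Q(2) by (metis det_I det_mul)
  then show "det A = det B" unfolding A by (simp add: det_mul algebra_simps)
qed

text \<open>The two off-diagonal matrix units suffice. This identifies a matrix with trivial adjoint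
  action as a scalar.\<close>

lemma matrix_commuting_with_all:
  fixes A :: "'a::comm_ring_1 ^ 2 ^ 2"
  assumes "\<And>M. A ** M = M ** A"
  shows "A = mat (A $ 1 $ 1)"
proof -
  define E :: "'a ^ 2 ^ 2" where "E = vector [vector [0, 1], vector [0, 0]]"
  define F :: "'a ^ 2 ^ 2" where "F = vector [vector [0, 0], vector [1, 0]]"
  have "(A ** E) $ 1 $ 2 = (E ** A) $ 1 $ 2" "(A ** E) $ 2 $ 2 = (E ** A) $ 2 $ 2"
    "(A ** F) $ 1 $ 1 = (F ** A) $ 1 $ 1"
    by (simp_all add: assms)
  then show ?thesis
    unfolding matrix_eq_2 by (simp add: matrix_mult_2 E_def F_def)
qed

locale index_two =
  fixes G :: "('g, 'x) monoid_scheme" and H :: "'g set" and \<sigma> :: 'g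
  assumes normal_H: "H \<lhd> G" and index: "card (rcosets\<^bsub>G\<^esub> H) = 2"
    and sigma: "\<sigma> \<in> carrier G - H"
begin

sublocale group G
  using normal_H normal.axioms by (auto simp: normal_def)

lemma subgroup_H: "subgroup H G"
  using normal_H by (simp add: normal_def)

lemma sigma_carrier [simp]: "\<sigma> \<in> carrier G"
  using sigma by simp

lemma H_carrier: "h \<in> H \<Longrightarrow> h \<in> carrier G"
  using subgroup.mem_carrier[OF subgroup_H] .

lemma conj_H: "h \<in> H \<Longrightarrow> g \<in> carrier G \<Longrightarrow> g \<otimes>\<^bsub>G\<^esub> h \<otimes>\<^bsub>G\<^esub> inv\<^bsub>G\<^esub> g \<in> H"
  using normal.inv_op_closed2[OF normal_H] by blast

text \<open>\<open>H\<close> and its coset through \<open>\<sigma>\<close> are distinct, so they are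
  the only two right cosets.\<close>

lemma coset_cases:
  assumes g: "g \<in> carrier G"
  obtains "g \<in> H" | h where "h \<in> H" "g = h \<otimes>\<^bsub>G\<^esub> \<sigma>"
proof -
  let ?C = "rcosets\<^bsub>G\<^esub> H"
  have H: "H \<subseteq> carrier G" using subgroup_H by (rule subgroup.subset)
  have 1: "H \<in> ?C" using subgroup.subgroup_in_rcosets[OF subgroup_H group_axioms] .
  have 2: "H #>\<^bsub>G\<^esub> \<sigma> \<in> ?C" by (rule rcosetsI[OF H sigma_carrier])
  have 3: "H \<noteq> H #>\<^bsub>G\<^esub> \<sigma>" using rcos_self[OF sigma_carrier subgroup_H] sigma by auto
  have fin: "finite ?C" using index by (intro card_ge_0_finite) simp
  have "{H, H #>\<^bsub>G\<^esub> \<sigma>} = ?C" using 1 2 3 index by (intro card_subset_eq[OF fin]) auto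
  moreover have "H #>\<^bsub>G\<^esub> g \<in> ?C" by (rule rcosetsI[OF H g])
  moreover have "g \<in> H #>\<^bsub>G\<^esub> g" by (rule rcos_self[OF g subgroup_H])
  ultimately have "g \<in> H \<or> g \<in> H #>\<^bsub>G\<^esub> \<sigma>" by auto
  then show thesis using that by (auto simp: r_coset_def)
qed

section \<open>The induced module in coordinates\<close>

text \<open>\<open>1\<close> and \<open>\<sigma>\<close> represent the two cosets of
  \<open>H\<close>, and their values propagate along cosets through \<open>chi\<close>.\<close>

lemma Ind_eqI:
  assumes "f \<in> Ind G H chi" "f' \<in> Ind G H chi" "f \<one>\<^bsub>G\<^esub> = f' \<one>\<^bsub>G\<^esub>" "f \<sigma> = f' \<sigma>"
  shows "f = f'"
proof (rule extensionalityI[of _ "carrier G"])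
  show "f \<in> extensional (carrier G)" "f' \<in> extensional (carrier G)"
    using assms by (simp_all add: Ind_def)
  have *: "f (h \<otimes>\<^bsub>G\<^esub> g) = chi h * f g" "f' (h \<otimes>\<^bsub>G\<^esub> g) = chi h * f' g"
    if "h \<in> H" "g \<in> carrier G" for h g
    using assms that by (simp_all add: Ind_def)
  fix g assume "g \<in> carrier G"
  then show "f g = f' g"
  proof (cases rule: coset_cases)
    case 1
    then show ?thesis using *[OF 1 one_closed] assms(3) H_carrier by simp
  next
    case (2 h)
    then show ?thesis using *[OF 2(1) sigma_carrier] assms(4) by simp
  qed
qed

text \<open>Normality lets \<open>h\<close> be moved to the left of \<open>g\<close>, so
  \<open>H\<close> acts on the value at \<open>g\<close> through a conjugate of
  \<open>chi\<close>.\<close>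

lemma Ind_act_H:
  assumes "f \<in> Ind G H chi" "h \<in> H" "g \<in> carrier G"
  shows "Ind_act G h f g = chi (g \<otimes>\<^bsub>G\<^esub> h \<otimes>\<^bsub>G\<^esub> inv\<^bsub>G\<^esub> g) * f g"
proof -
  have "g \<otimes>\<^bsub>G\<^esub> h = (g \<otimes>\<^bsub>G\<^esub> h \<otimes>\<^bsub>G\<^esub> inv\<^bsub>G\<^esub> g) \<otimes>\<^bsub>G\<^esub> g"
    using assms H_carrier by (simp add: m_assoc)
  moreover have "f ((g \<otimes>\<^bsub>G\<^esub> h \<otimes>\<^bsub>G\<^esub> inv\<^bsub>G\<^esub> g) \<otimes>\<^bsub>G\<^esub> g) = chi (g \<otimes>\<^bsub>G\<^esub> h \<otimes>\<^bsub>G\<^esub> inv\<^bsub>G\<^esub> g) * f g"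
    using assms conj_H by (simp add: Ind_def)
  ultimately show ?thesis using assms(3) by (simp add: Ind_act_def)
qed

text \<open>By \<open>Ind_act_H\<close> each element of \<open>H\<close> multiplies every value by a
  scalar, and scalars commute; injectivity of \<open>\<phi>\<close> carries this back to
  matrices.\<close>

lemma commute_if_equivalent_to_Ind:
  fixes \<rho> :: "'g \<Rightarrow> 'r::comm_ring_1 ^ 2 ^ 2"
  assumes "equivalent_to_Ind G H chi \<rho>" "h \<in> H" "k \<in> H"
  shows "\<rho> h ** \<rho> k = \<rho> k ** \<rho> h"
proof -
  obtain \<phi> where bij: "bij_betw \<phi> UNIV (Ind G H chi)"
    and act: "\<And>k v. k \<in> carrier G \<Longrightarrow> \<phi> (\<rho> k *v v) = Ind_act G k (\<phi> v)"
    using assms(1) unfolding equivalent_to_Ind_def by blast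
  have Ind: "\<phi> v \<in> Ind G H chi" for v using bij by (auto simp: bij_betw_def)
  have *: "\<phi> (\<rho> h *v (\<rho> k *v v)) g =
      chi (g \<otimes>\<^bsub>G\<^esub> h \<otimes>\<^bsub>G\<^esub> inv\<^bsub>G\<^esub> g) * (chi (g \<otimes>\<^bsub>G\<^esub> k \<otimes>\<^bsub>G\<^esub> inv\<^bsub>G\<^esub> g) * \<phi> v g)"
    if "h \<in> H" "k \<in> H" "g \<in> carrier G" for h k v g
    using that act[OF H_carrier] Ind_act_H[OF Ind] by metis
  have "\<rho> h *v (\<rho> k *v v) = \<rho> k *v (\<rho> h *v v)" for v
  proof -
    have "\<phi> (\<rho> h *v (\<rho> k *v v)) = \<phi> (\<rho> k *v (\<rho> h *v v))"
      by (rule extensionalityI[of _ "carrier G"])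
        (use Ind assms in \<open>auto simp: Ind_def * mult.left_commute\<close>)
    then show ?thesis using bij by (metis bij_betw_def injD)
  qed
  then show ?thesis by (simp add: matrix_eq matrix_vector_mul_assoc)
qed

text \<open>\<open>P\<close> is the matrix of
  \<open>v \<mapsto> (\<phi> v 1, \<phi> v \<sigma>)\<close>. Over a field its injectivity makes it
  invertible.\<close>

lemma diagonalize_if_equivalent_to_Ind:
  fixes \<rho> :: "'g \<Rightarrow> 'f::field ^ 2 ^ 2"
  assumes "equivalent_to_Ind G H chi \<rho>"
  obtains P where "invertible P"
    "\<And>h. h \<in> H \<Longrightarrow> P ** \<rho> h = diag2 (chi h) (chi (\<sigma> \<otimes>\<^bsub>G\<^esub> h \<otimes>\<^bsub>G\<^esub> inv\<^bsub>G\<^esub> \<sigma>)) ** P"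
    "(P ** \<rho> \<sigma>) $ 1 = P $ 2"
proof -
  obtain \<phi> where bij: "bij_betw \<phi> UNIV (Ind G H chi)"
    and add: "\<And>u v. \<phi> (u + v) = (\<lambda>g\<in>carrier G. \<phi> u g + \<phi> v g)"
    and scale: "\<And>c v. \<phi> (c *s v) = (\<lambda>g\<in>carrier G. c * \<phi> v g)"
    and act: "\<And>k v. k \<in> carrier G \<Longrightarrow> \<phi> (\<rho> k *v v) = Ind_act G k (\<phi> v)"
    using assms(1) unfolding equivalent_to_Ind_def by blast
  have Ind: "\<phi> v \<in> Ind G H chi" for v using bij by (auto simp: bij_betw_def)
  define P :: "'f ^ 2 ^ 2" where
    "P = vector [vector [\<phi> (axis 1 1) \<one>\<^bsub>G\<^esub>, \<phi> (axis 2 1) \<one>\<^bsub>G\<^esub>], vector [\<phi> (axis 1 1) \<sigma>, \<phi> (axis 2 1) \<sigma>]]"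
  have lin: "\<phi> v g = v $ 1 * \<phi> (axis 1 1) g + v $ 2 * \<phi> (axis 2 1) g" if "g \<in> carrier G" for v g
  proof -
    have "v = v $ 1 *s axis 1 1 + v $ 2 *s axis 2 1"
      by (simp add: vec_eq_iff forall_2 axis_def)
    then have "\<phi> v g = \<phi> (v $ 1 *s axis 1 1 + v $ 2 *s axis 2 1) g" by simp
    then show ?thesis using that by (simp add: add scale)
  qed
  have P: "(P *v v) $ 1 = \<phi> v \<one>\<^bsub>G\<^esub>" "(P *v v) $ 2 = \<phi> v \<sigma>" for v
    by (simp_all add: P_def matrix_vector_mult_def sum_2 lin[of "\<one>\<^bsub>G\<^esub>" v] lin[of \<sigma> v] mult.commute)
  have "inj ((*v) P)"
  proof (rule injI)
    fix u v assume "P *v u = P *v v"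
    then have "\<phi> u \<one>\<^bsub>G\<^esub> = \<phi> v \<one>\<^bsub>G\<^esub>" "\<phi> u \<sigma> = \<phi> v \<sigma>" by (simp_all flip: P)
    then have "\<phi> u = \<phi> v" by (rule Ind_eqI[OF Ind Ind])
    then show "u = v" using bij by (metis bij_betw_def injD)
  qed
  then have inv: "invertible P"
    using matrix_left_invertible_injective[of P] invertible_left_inverse[of P] by blast
  have diag: "P ** \<rho> h = diag2 (chi h) (chi (\<sigma> \<otimes>\<^bsub>G\<^esub> h \<otimes>\<^bsub>G\<^esub> inv\<^bsub>G\<^esub> \<sigma>)) ** P" if h: "h \<in> H" for h
  proof -
    have "P *v (\<rho> h *v v) = diag2 (chi h) (chi (\<sigma> \<otimes>\<^bsub>G\<^esub> h \<otimes>\<^bsub>G\<^esub> inv\<^bsub>G\<^esub> \<sigma>)) *v (P *v v)" for v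
    proof -
      have "(P *v (\<rho> h *v v)) $ 1 = chi h * (P *v v) $ 1"
        unfolding P act[OF H_carrier[OF h]] using Ind_act_H[OF Ind h one_closed] H_carrier[OF h] by simp
      moreover have "(P *v (\<rho> h *v v)) $ 2 = chi (\<sigma> \<otimes>\<^bsub>G\<^esub> h \<otimes>\<^bsub>G\<^esub> inv\<^bsub>G\<^esub> \<sigma>) * (P *v v) $ 2"
        unfolding P act[OF H_carrier[OF h]] using Ind_act_H[OF Ind h sigma_carrier] by simp
      ultimately show ?thesis
        unfolding vec_eq_iff[of "P *v (\<rho> h *v v)"] forall_2
        by (simp add: matrix_vector_mult_def[of "diag2 _ _"] sum_2)
    qed
    then show ?thesis by (simp add: matrix_eq matrix_vector_mul_assoc)
  qed
  \<comment> \<open>Translating by \<open>\<sigma>\<close> and evaluating at \<open>1\<close> is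
    evaluation at \<open>\<sigma>\<close>.\<close>
  have "(P *v (\<rho> \<sigma> *v v)) $ 1 = (P *v v) $ 2" for v
    unfolding P act[OF sigma_carrier] by (simp add: Ind_act_def)
  then have "((P ** \<rho> \<sigma>) *v axis j 1) $ 1 = (P *v axis j 1) $ 2" for j
    by (simp add: matrix_vector_mul_assoc)
  moreover have "(A *v axis j 1) $ i = A $ i $ j" for A :: "'f ^ 2 ^ 2" and i j
    using exhaust_2[of j] by (auto simp: matrix_vector_mult_def sum_2 axis_def)
  ultimately have "(P ** \<rho> \<sigma>) $ 1 $ j = P $ 2 $ j" for j
    by simp
  then have "(P ** \<rho> \<sigma>) $ 1 = P $ 2" by (simp add: vec_eq_iff)
  with inv diag show thesis by (rule that)
qed

end

section \<open>Lifts of residually dihedral representations\<close>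

locale residually_dihedral = index_two G H \<sigma> + coefficient_ring p \<alpha> \<pi>
  for G :: "('g, 'x) monoid_scheme" and H \<sigma> and p
    and \<alpha> :: "(nat \<Rightarrow> 'f::field) \<Rightarrow> 'r::comm_ring_1" and \<pi> +
  fixes T :: "'g topology" and chibar :: "'g \<Rightarrow> 'f" and \<rho>bar :: "'g \<Rightarrow> 'f ^ 2 ^ 2"
    and \<rho> :: "'g \<Rightarrow> 'r ^ 2 ^ 2" and s :: "'f ^ 2 ^ 2 \<Rightarrow> 'r ^ 2 ^ 2"
  assumes residue_char: "of_nat p = (0 :: 'f)"
    and chibar_ne: "\<exists>h\<in>H. chibar h \<noteq> chibar (\<sigma> \<otimes>\<^bsub>G\<^esub> h \<otimes>\<^bsub>G\<^esub> inv\<^bsub>G\<^esub> \<sigma>)"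
    and rhobar_hom: "\<rho>bar \<in> hom G GL2"
    and rhobar_Ind: "equivalent_to_Ind G H chibar \<rho>bar"
    and rho_rep: "is_representation G T adic_topology \<rho>"
    and rho_lift: "\<And>g. g \<in> carrier G \<Longrightarrow> map_matrix \<pi> (\<rho> g) = \<rho>bar g"
    and s_hom: "s \<in> hom (GL2\<lparr>carrier := \<rho>bar ` H\<rparr>) (GL2\<lparr>carrier := \<rho> ` H\<rparr>)"
    and s_lift: "\<And>y. y \<in> \<rho>bar ` H \<Longrightarrow> map_matrix \<pi> (s y) = y"
begin

abbreviation (input) \<Gamma> :: "('r ^ 2 ^ 2) set" where "\<Gamma> \<equiv> residual_kernel G \<pi> \<rho>bar \<rho>"
abbreviation (input) \<G> :: "('r ^ 2 ^ 2) topology" where "\<G> \<equiv> GL2_topology adic_topology"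

sublocale rho: group_hom G GL2 \<rho>
  using rho_rep by unfold_locales (simp add: is_representation_def)

sublocale rhobar: group_hom G GL2 \<rho>bar
  using rhobar_hom by unfold_locales

lemma rho_mult: "g \<in> carrier G \<Longrightarrow> h \<in> carrier G \<Longrightarrow> \<rho> (g \<otimes>\<^bsub>G\<^esub> h) = \<rho> g ** \<rho> h"
  using rho.hom_mult by simp

lemma rhobar_mult: "g \<in> carrier G \<Longrightarrow> h \<in> carrier G \<Longrightarrow> \<rho>bar (g \<otimes>\<^bsub>G\<^esub> h) = \<rho>bar g ** \<rho>bar h"
  using rhobar.hom_mult by simp

lemma rho_one: "\<rho> \<one>\<^bsub>G\<^esub> = mat 1"
  using rho.hom_one by simp

lemma invertible_rho: "g \<in> carrier G \<Longrightarrow> invertible (\<rho> g)"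
  using rho.hom_closed by simp

lemma invertible_rhobar: "g \<in> carrier G \<Longrightarrow> invertible (\<rho>bar g)"
  using rhobar.hom_closed by simp

lemma s_image: "h \<in> H \<Longrightarrow> s (\<rho>bar h) \<in> \<rho> ` H"
  using s_hom by (auto simp: hom_def)

lemma invertible_s: "h \<in> H \<Longrightarrow> invertible (s (\<rho>bar h))"
  using s_image[of h] invertible_rho H_carrier by auto

lemma s_mult: "h \<in> H \<Longrightarrow> k \<in> H \<Longrightarrow> s (\<rho>bar h ** \<rho>bar k) = s (\<rho>bar h) ** s (\<rho>bar k)"
  using s_hom by (auto simp: hom_def)

lemma Gamma_iff: "x \<in> \<Gamma> \<longleftrightarrow> (\<exists>g\<in>carrier G. x = \<rho> g \<and> \<rho>bar g = mat 1)"
  unfolding residual_kernel_def kernel_def using rho_lift by auto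

lemma subgroup_residual_kernel: "subgroup \<Gamma> GL2"
proof (rule GL2.subgroupI)
  show "\<Gamma> \<subseteq> carrier GL2" using invertible_rho by (auto simp: Gamma_iff)
  have "\<rho>bar \<one>\<^bsub>G\<^esub> = mat 1" using rhobar.hom_one by simp
  then have "\<rho> \<one>\<^bsub>G\<^esub> \<in> \<Gamma>" unfolding Gamma_iff using one_closed by blast
  then show "\<Gamma> \<noteq> {}" by blast
next
  fix x assume "x \<in> \<Gamma>"
  then obtain g where g: "g \<in> carrier G" "x = \<rho> g" "\<rho>bar g = mat 1" by (auto simp: Gamma_iff)
  have "inv\<^bsub>GL2\<^esub> (mat 1 :: 'f ^ 2 ^ 2) = mat 1" using GL2.inv_one by simp
  then show "inv\<^bsub>GL2\<^esub> x \<in> \<Gamma>"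
    using g rho.hom_inv[OF g(1)] rhobar.hom_inv[OF g(1)]
    by (auto simp: Gamma_iff intro!: bexI[of _ "inv\<^bsub>G\<^esub> g"])
next
  fix x y assume "x \<in> \<Gamma>" "y \<in> \<Gamma>"
  then obtain g h where "g \<in> carrier G" "x = \<rho> g" "\<rho>bar g = mat 1"
    "h \<in> carrier G" "y = \<rho> h" "\<rho>bar h = mat 1" by (auto simp: Gamma_iff)
  then show "x \<otimes>\<^bsub>GL2\<^esub> y \<in> \<Gamma>"
    by (auto simp: Gamma_iff rho_mult rhobar_mult intro!: bexI[of _ "g \<otimes>\<^bsub>G\<^esub> h"])
qed

sublocale residually_trivial_group p \<alpha> \<pi> \<Gamma>
proof (intro residually_trivial_group.intro residually_trivial_group_axioms.intro coefficient_ring_axioms)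
  show "of_nat p = (0 :: 'f)" by (rule residue_char)
  show "subgroup \<Gamma> GL2" by (rule subgroup_residual_kernel)
  show "map_matrix \<pi> x = mat 1" if "x \<in> \<Gamma>" for x
    using that rho_lift by (auto simp: Gamma_iff)
qed

section \<open>Consequences of the residual diagonalization\<close>

lemma diagonalize:
  obtains P where "invertible P"
    "\<And>h. h \<in> H \<Longrightarrow> P ** \<rho>bar h = diag2 (chibar h) (chibar (\<sigma> \<otimes>\<^bsub>G\<^esub> h \<otimes>\<^bsub>G\<^esub> inv\<^bsub>G\<^esub> \<sigma>)) ** P"
    "(P ** \<rho>bar \<sigma>) $ 1 = P $ 2"
  using diagonalize_if_equivalent_to_Ind[OF rhobar_Ind] by blast

lemma rhobar_H_commute: "h \<in> H \<Longrightarrow> k \<in> H \<Longrightarrow> \<rho>bar h ** \<rho>bar k = \<rho>bar k ** \<rho>bar h"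
  by (rule commute_if_equivalent_to_Ind[OF rhobar_Ind])

text \<open>Residually, an element outside \<open>H\<close> interchanges the two coordinate lines,
  so it cannot be trivial: the rows of \<open>P\<close> would be proportional.\<close>

lemma Gamma_subset_rho_H: "\<Gamma> \<subseteq> \<rho> ` H"
proof
  fix x assume "x \<in> \<Gamma>"
  then obtain g where g: "g \<in> carrier G" "x = \<rho> g" "\<rho>bar g = mat 1" by (auto simp: Gamma_iff)
  from g(1) show "x \<in> \<rho> ` H"
  proof (cases rule: coset_cases)
    case 1
    then show ?thesis using g by blast
  next
    case (2 h)
    obtain P where P: "invertible P"
      "P ** \<rho>bar h = diag2 (chibar h) (chibar (\<sigma> \<otimes>\<^bsub>G\<^esub> h \<otimes>\<^bsub>G\<^esub> inv\<^bsub>G\<^esub> \<sigma>)) ** P"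
      "(P ** \<rho>bar \<sigma>) $ 1 = P $ 2"
      using diagonalize 2(1) by metis
    have "P = P ** (\<rho>bar h ** \<rho>bar \<sigma>)"
      using g 2 rhobar_mult[OF H_carrier[OF 2(1)] sigma_carrier] by simp
    also have "\<dots> = diag2 (chibar h) (chibar (\<sigma> \<otimes>\<^bsub>G\<^esub> h \<otimes>\<^bsub>G\<^esub> inv\<^bsub>G\<^esub> \<sigma>)) ** (P ** \<rho>bar \<sigma>)"
      by (simp add: P matrix_mul_assoc)
    finally have "P $ 1 $ j = chibar h * P $ 2 $ j" for j
      using P(3) by (metis diag2_nth(1,2) add.right_neutral matrix_mult_2 mult_zero_left)
    then have "det P = 0" by (simp add: det_2)
    then show ?thesis using P(1) invertible_det_nz by blast
  qed
qed

text \<open>The two factors have the same residue, and \<open>s (\<rho>bar h)\<close> is itself a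
  value of \<open>\<rho>\<close>. This is the component along \<open>\<Gamma>\<close> in the
  decomposition by the splitting.\<close>

lemma Gamma_part:
  assumes "h \<in> H"
  shows "\<rho> h ** inv\<^bsub>GL2\<^esub> (s (\<rho>bar h)) \<in> \<Gamma>"
proof -
  obtain k where k: "k \<in> H" "s (\<rho>bar h) = \<rho> k" using s_image[OF assms] by blast
  have kb: "\<rho>bar k = \<rho>bar h"
    using s_lift[of "\<rho>bar h"] rho_lift[OF H_carrier[OF k(1)]] k(2) assms by simp
  have c: "h \<in> carrier G" "k \<in> carrier G" using assms k H_carrier by auto
  have "\<rho> h ** inv\<^bsub>GL2\<^esub> (s (\<rho>bar h)) = \<rho> (h \<otimes>\<^bsub>G\<^esub> inv\<^bsub>G\<^esub> k)"
    using c k rho.hom_inv[OF c(2)] by (simp add: rho_mult)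
  moreover have "\<rho>bar (h \<otimes>\<^bsub>G\<^esub> inv\<^bsub>G\<^esub> k) = mat 1"
    using c kb rhobar.hom_inv[OF c(2)] GL2_inv(2)[OF invertible_rhobar[OF c(1)]]
    by (simp add: rhobar_mult)
  moreover have "h \<otimes>\<^bsub>G\<^esub> inv\<^bsub>G\<^esub> k \<in> carrier G" using c by simp
  ultimately show ?thesis unfolding Gamma_iff by blast
qed

text \<open>Exposes the preimage selected by \<open>SOME\<close> as \<open>\<rho>bar h\<close>, with
  one \<open>h\<close> serving all \<open>x\<close>.\<close>

lemma ad_act_eq:
  assumes "a \<in> ad_image H \<rho>bar"
  obtains h where "h \<in> H" "Ad (\<rho>bar h) = a"
    "\<And>x. ad_act H \<rho>bar s a x = s (\<rho>bar h) ** x ** inv\<^bsub>GL2\<^esub> (s (\<rho>bar h))"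
proof -
  define y where "y = (SOME y. y \<in> \<rho>bar ` H \<and> Ad y = a)"
  have "\<exists>y. y \<in> \<rho>bar ` H \<and> Ad y = a" using assms by (auto simp: ad_image_def)
  then have "y \<in> \<rho>bar ` H \<and> Ad y = a" unfolding y_def by (rule someI_ex)
  then obtain h where h: "h \<in> H" "y = \<rho>bar h" "Ad y = a" by blast
  show thesis
    using h by (intro that[of h]) (simp_all add: ad_act_def y_def[symmetric] Let_def)
qed

text \<open>
  The element \<open>k\<close> replaces an \<open>h\<close> with \<open>chibar h \<noteq> chibar (\<sigma> h \<sigma>\<inverse>)\<close>, because \<open>ad_act\<close> may
  choose another preimage of the same element of the adjoint image.
\<close>

lemma regular_element:
  obtains a k where "a \<in> ad_image H \<rho>bar" "k \<in> H"
    "chibar k \<noteq> chibar (\<sigma> \<otimes>\<^bsub>G\<^esub> k \<otimes>\<^bsub>G\<^esub> inv\<^bsub>G\<^esub> \<sigma>)"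
    "\<And>x. ad_act H \<rho>bar s a x = s (\<rho>bar k) ** x ** inv\<^bsub>GL2\<^esub> (s (\<rho>bar k))"
proof -
  obtain h where h: "h \<in> H" "chibar h \<noteq> chibar (\<sigma> \<otimes>\<^bsub>G\<^esub> h \<otimes>\<^bsub>G\<^esub> inv\<^bsub>G\<^esub> \<sigma>)"
    using chibar_ne by blast
  have a: "Ad (\<rho>bar h) \<in> ad_image H \<rho>bar" using h by (auto simp: ad_image_def)
  obtain k where k: "k \<in> H" "Ad (\<rho>bar k) = Ad (\<rho>bar h)"
    "\<And>x. ad_act H \<rho>bar s (Ad (\<rho>bar h)) x = s (\<rho>bar k) ** x ** inv\<^bsub>GL2\<^esub> (s (\<rho>bar k))"
    using ad_act_eq[OF a] by blast
  obtain P where P: "invertible P"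
    "\<And>h. h \<in> H \<Longrightarrow> P ** \<rho>bar h = diag2 (chibar h) (chibar (\<sigma> \<otimes>\<^bsub>G\<^esub> h \<otimes>\<^bsub>G\<^esub> inv\<^bsub>G\<^esub> \<sigma>)) ** P"
    using diagonalize by metis
  obtain Q where Q: "P ** Q = mat 1" "Q ** P = mat 1" using P(1) by (auto simp: invertible_def)
  \<comment> \<open>Equal eigenvalues would make \<open>\<rho>bar k\<close> scalar, so its adjoint
    action, which is also that of \<open>\<rho>bar h\<close>, would be trivial; then
    \<open>\<rho>bar h\<close> would be scalar too.\<close>
  have "chibar k \<noteq> chibar (\<sigma> \<otimes>\<^bsub>G\<^esub> k \<otimes>\<^bsub>G\<^esub> inv\<^bsub>G\<^esub> \<sigma>)"
  proof
    assume eq: "chibar k = chibar (\<sigma> \<otimes>\<^bsub>G\<^esub> k \<otimes>\<^bsub>G\<^esub> inv\<^bsub>G\<^esub> \<sigma>)"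
    have "diag2 (chibar k) (chibar k) = mat (chibar k)" unfolding matrix_eq_2 by simp
    then have "P ** \<rho>bar k = mat (chibar k) ** P" using P(2)[OF k(1)] eq by simp
    then have "Q ** (P ** \<rho>bar k) = Q ** (P ** mat (chibar k))" by (simp add: mat_mult_commute)
    then have scalar: "\<rho>bar k = mat (chibar k)" using Q by (simp add: matrix_mul_assoc)
    have inv: "invertible (\<rho>bar k)" "invertible (\<rho>bar h)"
      using invertible_rhobar H_carrier h k by auto
    have "Ad (\<rho>bar k) M = M" for M
      using conj_eq_iff[OF inv(1), of M M] by (simp add: Ad_def scalar mat_mult_commute)
    then have "Ad (\<rho>bar h) M = M" for M using k(2) by simp
    then have "\<rho>bar h ** M = M ** \<rho>bar h" for M
      unfolding Ad_def conj_eq_iff[OF inv(2)] .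
    then obtain t where "\<rho>bar h = mat t" using matrix_commuting_with_all by blast
    then have "mat t ** P = diag2 (chibar h) (chibar (\<sigma> \<otimes>\<^bsub>G\<^esub> h \<otimes>\<^bsub>G\<^esub> inv\<^bsub>G\<^esub> \<sigma>)) ** P"
      using P(2)[OF h(1)] by (simp add: mat_mult_commute)
    then have "mat t = diag2 (chibar h) (chibar (\<sigma> \<otimes>\<^bsub>G\<^esub> h \<otimes>\<^bsub>G\<^esub> inv\<^bsub>G\<^esub> \<sigma>))"
      using Q(1) by (metis matrix_mul_assoc matrix_mul_rid)
    then show False using h(2) unfolding matrix_eq_2 by auto
  qed
  with a k show thesis by (intro that[of "Ad (\<rho>bar h)" k]) auto
qed

text \<open>The characteristic polynomial of \<open>s (\<rho>bar k)\<close> reduces to that of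
  \<open>\<rho>bar k\<close>, which has distinct roots, so Hensel lifting applies.\<close>

lemma eigenvalues_lift:
  assumes k: "k \<in> H" "chibar k \<noteq> chibar (\<sigma> \<otimes>\<^bsub>G\<^esub> k \<otimes>\<^bsub>G\<^esub> inv\<^bsub>G\<^esub> \<sigma>)"
  obtains x y c where "trace (s (\<rho>bar k)) = x + y" "det (s (\<rho>bar k)) = x * y" "(x - y) * c = 1"
    "\<pi> x = chibar k" "\<pi> y = chibar (\<sigma> \<otimes>\<^bsub>G\<^esub> k \<otimes>\<^bsub>G\<^esub> inv\<^bsub>G\<^esub> \<sigma>)"
proof -
  define a where "a = chibar k"
  define b where "b = chibar (\<sigma> \<otimes>\<^bsub>G\<^esub> k \<otimes>\<^bsub>G\<^esub> inv\<^bsub>G\<^esub> \<sigma>)"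
  define D where "D = s (\<rho>bar k)"
  obtain P where P: "invertible P" "P ** \<rho>bar k = diag2 a b ** P"
    using diagonalize k(1) unfolding a_def b_def by metis
  have "map_matrix \<pi> D = \<rho>bar k" using k s_lift by (simp add: D_def)
  then have tr: "\<pi> (trace D) = a + b" and dt: "\<pi> (det D) = a * b"
    using similar_trace_det[OF P] trace_map_matrix[of D] det_map_matrix[of D]
    by (simp_all add: trace_2[of "diag2 a b"] det_2[of "diag2 a b"])
  obtain x where x: "x * x - trace D * x + det D = 0" "\<pi> x = a"
  proof (rule quadratic_root_lift[of a "trace D" "det D"])
    show "a * a - \<pi> (trace D) * a + \<pi> (det D) = 0" by (simp add: tr dt algebra_simps)
    show "2 * a - \<pi> (trace D) \<noteq> 0" using k(2) by (simp add: tr a_def b_def)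
  qed
  \<comment> \<open>Only one root is lifted; the trace determines the other, and the quadratic
    equation for \<open>x\<close> then gives the determinant.\<close>
  define y where "y = trace D - x"
  have y: "\<pi> y = b" by (simp add: y_def tr x)
  obtain c where "(x - y) * c = 1"
    using unit_if_residue_nz[of "x - y"] x y k(2) by (auto simp: a_def b_def)
  moreover have "det D = x * y" using x(1) by (simp add: y_def algebra_simps)
  ultimately show thesis
    using x y by (intro that[of x y c]) (simp_all add: y_def D_def a_def b_def)
qed

text \<open>\<open>\<rho> h\<close> is a product of an element of \<open>\<Gamma>\<close> and a
  value of \<open>s\<close>; the latter commutes with \<open>s (\<rho>bar k)\<close> because
  \<open>\<rho>bar\<close> is abelian on \<open>H\<close>.\<close>

lemma rho_H_commute:
  assumes k: "k \<in> H" and comm: "\<And>x. x \<in> \<Gamma> \<Longrightarrow> s (\<rho>bar k) ** x = x ** s (\<rho>bar k)"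
    and h: "h \<in> H"
  shows "s (\<rho>bar k) ** \<rho> h = \<rho> h ** s (\<rho>bar k)"
proof -
  let ?D = "s (\<rho>bar k)" and ?z = "s (\<rho>bar h)"
  define x where "x = \<rho> h ** inv\<^bsub>GL2\<^esub> ?z"
  have x: "x \<in> \<Gamma>" unfolding x_def by (rule Gamma_part[OF h])
  have rho: "\<rho> h = x ** ?z"
    unfolding x_def using GL2_inv(3)[OF invertible_s[OF h]] by (metis matrix_mul_assoc matrix_mul_rid)
  have "?D ** ?z = ?z ** ?D"
    using s_mult[OF k h] s_mult[OF h k] rhobar_H_commute[OF h k] by simp
  then show ?thesis unfolding rho using comm[OF x] by (metis matrix_mul_assoc)
qed

text \<open>Every \<open>\<rho> h\<close> with \<open>h \<in> H\<close> preserves the rank-one row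
  space of \<open>e\<close> and acts on it by \<open>chi h\<close>. A functional from this row
  space, evaluated on the translates of a vector, gives the map to the induced module.\<close>

lemma dihedral_if_commute:
  assumes k: "k \<in> H" "chibar k \<noteq> chibar (\<sigma> \<otimes>\<^bsub>G\<^esub> k \<otimes>\<^bsub>G\<^esub> inv\<^bsub>G\<^esub> \<sigma>)"
    and comm: "\<And>x. x \<in> \<Gamma> \<Longrightarrow> s (\<rho>bar k) ** x = x ** s (\<rho>bar k)"
  shows "dihedral G T H \<pi> chibar \<rho>"
proof -
  define D where "D = s (\<rho>bar k)"
  obtain x y c where D: "trace D = x + y" "det D = x * y" "(x - y) * c = 1"
    and xy: "\<pi> x = chibar k" "\<pi> y = chibar (\<sigma> \<otimes>\<^bsub>G\<^esub> k \<otimes>\<^bsub>G\<^esub> inv\<^bsub>G\<^esub> \<sigma>)"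
    unfolding D_def using eigenvalues_lift[OF k] by metis
  define e where "e = eigenprojection D y c"
  note e = eigenprojection[OF D, folded e_def]
  \<comment> \<open>As \<open>trace e = 1\<close>, the trace reads off the scalar in
    \<open>e ** \<rho> h = mat (chi h) ** e\<close>.\<close>
  define chi where "chi h = trace (e ** \<rho> h)" for h
  have e_rho: "e ** \<rho> h = mat (chi h) ** e" if "h \<in> H" for h
  proof -
    have "D ** \<rho> h = \<rho> h ** D" unfolding D_def by (rule rho_H_commute[OF k(1) comm that])
    then have "e ** \<rho> h = \<rho> h ** e"
      unfolding e_def by (rule eigenprojection_commute)
    then have "e ** \<rho> h = e ** \<rho> h ** e" using e(4) by (metis matrix_mul_assoc)
    then show ?thesis using singular_sandwich[OF e(6), of "\<rho> h"] by (simp add: chi_def)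
  qed
  have chi_one: "chi \<one>\<^bsub>G\<^esub> = 1" by (simp add: chi_def rho_one e)
  have chi_mult: "chi (g \<otimes>\<^bsub>G\<^esub> h) = chi g * chi h" if "g \<in> H" "h \<in> H" for g h
  proof -
    have "e ** \<rho> (g \<otimes>\<^bsub>G\<^esub> h) = mat (chi g) ** (e ** \<rho> h)"
      using that H_carrier e_rho[OF that(1)] by (simp add: rho_mult matrix_mul_assoc)
    then have "chi (g \<otimes>\<^bsub>G\<^esub> h) = trace (mat (chi g) ** (e ** \<rho> h))" by (simp add: chi_def)
    also have "\<dots> = chi g * chi h" by (simp add: chi_def trace_2[of "mat _ ** _"] trace_2[of "e ** \<rho> h"] distrib_left)
    finally show ?thesis .
  qed
  have character: "is_character G T H adic_topology chi"
    unfolding is_character_def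
  proof
    have unit: "chi h \<in> Units type_ring" if "h \<in> H" for h
    proof -
      have "inv\<^bsub>G\<^esub> h \<in> H" using subgroup.m_inv_closed[OF subgroup_H that] .
      then have "chi (inv\<^bsub>G\<^esub> h) * chi h = 1" "chi h * chi (inv\<^bsub>G\<^esub> h) = 1"
        using chi_mult[of h "inv\<^bsub>G\<^esub> h"] chi_one that H_carrier[OF that] by (simp_all add: mult.commute)
      then show ?thesis unfolding Units_def by auto
    qed
    then show "chi \<in> hom (G\<lparr>carrier := H\<rparr>) (units_of type_ring)"
      using chi_mult by (auto simp: hom_def units_of_carrier units_of_mult)
    have "continuous_map (subtopology T H) \<G> \<rho>"
      using rho_rep by (simp add: is_representation_def continuous_map_from_subtopology)
    then have "continuous_map (subtopology T H) adic_topology (\<lambda>h. (e ** \<rho> h) $ i $ j)" for i j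
      by (intro continuous_map_adic_matrix_mult continuous_map_adic_const) (simp add: continuous_map_GL2_iff)
    then show "continuous_map (subtopology T H) adic_topology chi"
      unfolding chi_def trace_2 by (intro continuous_map_adic_add)
  qed
  obtain P where P: "invertible P"
    "\<And>h. h \<in> H \<Longrightarrow> P ** \<rho>bar h = diag2 (chibar h) (chibar (\<sigma> \<otimes>\<^bsub>G\<^esub> h \<otimes>\<^bsub>G\<^esub> inv\<^bsub>G\<^esub> \<sigma>)) ** P"
    "(P ** \<rho>bar \<sigma>) $ 1 = P $ 2"
    using diagonalize by metis
  define ebar where "ebar = map_matrix \<pi> e"
  \<comment> \<open>In the basis given by \<open>P\<close>, \<open>e\<close> reduces to the
    projection onto the first coordinate; hence \<open>chi\<close> lifts \<open>chibar\<close> and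
    not its conjugate.\<close>
  have Pe: "P ** ebar = diag2 1 0 ** P"
  proof -
    let ?a = "\<pi> x" and ?b = "\<pi> y"
    have "map_matrix \<pi> D = \<rho>bar k" using k s_lift by (simp add: D_def)
    then have "ebar = mat (\<pi> c) ** (\<rho>bar k - mat ?b)"
      by (simp add: ebar_def e_def eigenprojection_def map_matrix_mult map_matrix_diff)
    then have "P ** ebar = mat (\<pi> c) ** (P ** \<rho>bar k - P ** mat ?b)"
      by (simp add: mat_mult_left_commute matrix_diff_ldistrib)
    also have "P ** \<rho>bar k - P ** mat ?b = (diag2 ?a ?b - mat ?b) ** P"
      by (simp add: P(2)[OF k(1)] xy mat_mult_commute[of P] matrix_diff_rdistrib)
    also have "mat (\<pi> c) ** ((diag2 ?a ?b - mat ?b) ** P) = mat (\<pi> c) ** (diag2 ?a ?b - mat ?b) ** P"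
      by (rule matrix_mul_assoc)
    also have "mat (\<pi> c) ** (diag2 ?a ?b - mat ?b) = diag2 1 0"
      using arg_cong[OF D(3), of \<pi>] unfolding matrix_eq_2 by (simp add: mult.commute)
    finally show ?thesis .
  qed
  have chi_lift: "\<pi> (chi h) = chibar h" if h: "h \<in> H" for h
  proof -
    have "P ** (ebar ** \<rho>bar h) = diag2 1 0 ** (P ** \<rho>bar h)"
      by (simp add: matrix_mul_assoc Pe)
    also have "\<dots> = diag2 (chibar h) 0 ** P"
      by (simp add: P(2)[OF h] matrix_mul_assoc diag2_mult)
    finally have "trace (ebar ** \<rho>bar h) = chibar h"
      using similar_trace_det(1)[OF P(1)] by (simp add: trace_2[of "diag2 _ _"])
    moreover have "\<pi> (chi h) = trace (ebar ** \<rho>bar h)"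
      unfolding chi_def ebar_def by (metis trace_map_matrix map_matrix_mult rho_lift H_carrier h)
    ultimately show ?thesis by simp
  qed
  \<comment> \<open>\<open>P\<close> is lifted entrywise; by \<open>Pe\<close>, the first row of
    \<open>Pt ** e\<close> reduces to the first row of \<open>P\<close>.\<close>
  obtain Pt :: "'r ^ 2 ^ 2" where Pt: "map_matrix \<pi> Pt = P"
  proof -
    have "map_matrix \<pi> (map_matrix (inv_into UNIV \<pi>) P) = P"
      using surj_pi by (simp add: matrix_eq_2 surj_f_inv_f)
    then show thesis by (rule that)
  qed
  define L where "L g = (Pt ** e ** \<rho> g) $ 1" for g
  \<comment> \<open>This is Frobenius reciprocity: the first row of \<open>Pt ** e\<close> is a
    functional on which \<open>\<rho> h\<close> acts through \<open>chi h\<close>, and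
    \<open>\<phi> v\<close> records its values on the translates of \<open>v\<close>.\<close>
  define \<phi> where "\<phi> v = (\<lambda>g\<in>carrier G. (Pt ** e ** \<rho> g *v v) $ 1)" for v
  define Q where "Q = (vector [L \<one>\<^bsub>G\<^esub>, L \<sigma>] :: 'r ^ 2 ^ 2)"
  \<comment> \<open>\<open>Q\<close> sends \<open>v\<close> to the values of \<open>\<phi> v\<close>
    at the coset representatives. The second row matches because \<open>\<rho>bar \<sigma>\<close>
    carries the first row of \<open>P\<close> to the second.\<close>
  have "map_matrix \<pi> Q = P"
  proof -
    have m: "map_matrix \<pi> (Pt ** e ** \<rho> g) = diag2 1 0 ** (P ** \<rho>bar g)" if "g \<in> carrier G" for g
      using that Pe by (simp add: map_matrix_mult Pt rho_lift ebar_def matrix_mul_assoc)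
    have L: "\<pi> (L g $ j) = (P ** \<rho>bar g) $ 1 $ j" if "g \<in> carrier G" for g j
    proof -
      have "\<pi> (L g $ j) = map_matrix \<pi> (Pt ** e ** \<rho> g) $ 1 $ j" by (simp add: L_def)
      then show ?thesis by (simp add: m[OF that] matrix_mult_2[of "diag2 _ _"])
    qed
    have "\<rho>bar \<one>\<^bsub>G\<^esub> = mat 1" using rhobar.hom_one by simp
    then show ?thesis
      unfolding matrix_eq_2 using L[OF one_closed] L[OF sigma_carrier] P(3) by (simp add: Q_def)
  qed
  then have "\<pi> (det Q) \<noteq> 0" using P(1) invertible_det_nz det_map_matrix[of Q] by metis
  then obtain q where "det Q * q = 1" by (rule unit_if_residue_nz)
  then have "invertible Q" by (rule invertible_if_det_unit)
  then obtain Q' where Q': "Q ** Q' = mat 1" "Q' ** Q = mat 1" by (auto simp: invertible_def)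
  have Qv: "(Q *v v) $ 1 = \<phi> v \<one>\<^bsub>G\<^esub>" "(Q *v v) $ 2 = \<phi> v \<sigma>" for v
    by (simp_all add: Q_def \<phi>_def L_def matrix_vector_mult_def)
  have Ind: "\<phi> v \<in> Ind G H chi" for v
  proof -
    have "\<phi> v (h \<otimes>\<^bsub>G\<^esub> g) = chi h * \<phi> v g" if h: "h \<in> H" and g: "g \<in> carrier G" for h g
    proof -
      have "Pt ** e ** \<rho> (h \<otimes>\<^bsub>G\<^esub> g) = Pt ** (e ** \<rho> h) ** \<rho> g"
        by (simp add: rho_mult[OF H_carrier[OF h] g] matrix_mul_assoc)
      also have "\<dots> = mat (chi h) ** (Pt ** e ** \<rho> g)"
        unfolding e_rho[OF h] by (simp add: mat_mult_left_commute matrix_mul_assoc[symmetric])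
      finally have eq: "Pt ** e ** \<rho> (h \<otimes>\<^bsub>G\<^esub> g) = mat (chi h) ** (Pt ** e ** \<rho> g)" .
      have "\<phi> v (h \<otimes>\<^bsub>G\<^esub> g) = (Pt ** e ** \<rho> (h \<otimes>\<^bsub>G\<^esub> g) *v v) $ 1"
        unfolding \<phi>_def using H_carrier[OF h] g by (intro restrict_apply') simp
      also have "\<dots> = chi h * (Pt ** e ** \<rho> g *v v) $ 1"
        unfolding eq by (simp add: matrix_vector_mult_def sum_2 mult.assoc distrib_left)
      finally show ?thesis using g by (simp add: \<phi>_def)
    qed
    then show ?thesis by (auto simp: Ind_def \<phi>_def)
  qed
  have "equivalent_to_Ind G H chi \<rho>"
    unfolding equivalent_to_Ind_def
  proof (intro exI[of _ \<phi>] conjI allI ballI)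
    show "bij_betw \<phi> UNIV (Ind G H chi)"
    proof (rule bij_betwI')
      fix u v
      have "u = v" if "\<phi> u = \<phi> v"
      proof -
        have "Q *v u = Q *v v" using that by (simp add: vec_eq_iff forall_2 Qv)
        then have "Q' *v (Q *v u) = Q' *v (Q *v v)" by simp
        then show ?thesis using Q' by (simp add: matrix_vector_mul_assoc)
      qed
      then show "(\<phi> u = \<phi> v) = (u = v)" by blast
      show "\<phi> u \<in> Ind G H chi" by (rule Ind)
    next
      fix f assume f: "f \<in> Ind G H chi"
      define v where "v = Q' *v vector [f \<one>\<^bsub>G\<^esub>, f \<sigma>]"
      have "Q *v v = vector [f \<one>\<^bsub>G\<^esub>, f \<sigma>]" using Q' by (simp add: v_def matrix_vector_mul_assoc)
      then have "f = \<phi> v" using Qv[of v] by (intro Ind_eqI[OF f Ind]) simp_all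
      then show "\<exists>v\<in>UNIV. f = \<phi> v" by blast
    qed
    show "\<phi> (u + v) = (\<lambda>g\<in>carrier G. \<phi> u g + \<phi> v g)" for u v
      by (auto simp: \<phi>_def matrix_vector_right_distrib)
    show "\<phi> (a *s v) = (\<lambda>g\<in>carrier G. a * \<phi> v g)" for a v
      by (auto simp: \<phi>_def matrix_vector_mult_def sum_2 algebra_simps)
    show "\<phi> (\<rho> g *v v) = Ind_act G g (\<phi> v)" if "g \<in> carrier G" for g v
      using that by (auto simp: \<phi>_def Ind_act_def rho_mult matrix_vector_mul_assoc matrix_mul_assoc)
  qed
  with character chi_lift show ?thesis unfolding dihedral_def by blast
qed

section \<open>Implications between the statements\<close>

lemma rho_H_commute_if_dihedral:
  assumes "dihedral G T H \<pi> chibar \<rho>" "x \<in> \<rho> ` H" "y \<in> \<rho> ` H"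
  shows "x ** y = y ** x"
  using assms commute_if_equivalent_to_Ind unfolding dihedral_def by blast

lemma trivial_if_dihedral:
  assumes "dihedral G T H \<pi> chibar \<rho>" "a \<in> ad_image H \<rho>bar" "x \<in> \<Gamma>"
  shows "ad_act H \<rho>bar s a x = x"
proof -
  obtain h where h: "h \<in> H" "ad_act H \<rho>bar s a x = s (\<rho>bar h) ** x ** inv\<^bsub>GL2\<^esub> (s (\<rho>bar h))"
    using ad_act_eq[OF assms(2)] by metis
  have "s (\<rho>bar h) ** x = x ** s (\<rho>bar h)"
    using rho_H_commute_if_dihedral[OF assms(1) s_image[OF h(1)]] assms(3) Gamma_subset_rho_H by blast
  then show ?thesis unfolding h(2) conj_eq_iff[OF invertible_s[OF h(1)]] .
qed

lemma dihedral_if_trivial: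
  assumes "\<forall>a\<in>ad_image H \<rho>bar. \<forall>x\<in>\<Gamma>. ad_act H \<rho>bar s a x = x"
  shows "dihedral G T H \<pi> chibar \<rho>"
proof -
  obtain a k where k: "a \<in> ad_image H \<rho>bar" "k \<in> H"
    "chibar k \<noteq> chibar (\<sigma> \<otimes>\<^bsub>G\<^esub> k \<otimes>\<^bsub>G\<^esub> inv\<^bsub>G\<^esub> \<sigma>)"
    "\<And>x. ad_act H \<rho>bar s a x = s (\<rho>bar k) ** x ** inv\<^bsub>GL2\<^esub> (s (\<rho>bar k))"
    using regular_element by blast
  show ?thesis
  proof (rule dihedral_if_commute[OF k(2,3)])
    fix x assume "x \<in> \<Gamma>"
    then have "s (\<rho>bar k) ** x ** inv\<^bsub>GL2\<^esub> (s (\<rho>bar k)) = x" using assms k(1,4) by metis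
    then show "s (\<rho>bar k) ** x = x ** s (\<rho>bar k)" using conj_eq_iff[OF invertible_s[OF k(2)]] by blast
  qed
qed

text \<open>Invariance of the coset of \<open>g\<close> says that conjugation by
  \<open>s (\<rho>bar k)\<close> multiplies \<open>g\<close> by some \<open>z \<in> \<Phi>\<close>,
  the input of \<open>commute_if_trivial_mod_frattini\<close>.\<close>

lemma dihedral_if_trivial_mod_frattini:
  assumes "\<forall>a\<in>ad_image H \<rho>bar. \<forall>C\<in>carrier (GL2\<lparr>carrier := \<Gamma>\<rparr> Mod \<Phi>). ad_act H \<rho>bar s a ` C = C"
  shows "dihedral G T H \<pi> chibar \<rho>"
proof -
  obtain a k where k: "a \<in> ad_image H \<rho>bar" "k \<in> H"
    "chibar k \<noteq> chibar (\<sigma> \<otimes>\<^bsub>G\<^esub> k \<otimes>\<^bsub>G\<^esub> inv\<^bsub>G\<^esub> \<sigma>)"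
    "\<And>x. ad_act H \<rho>bar s a x = s (\<rho>bar k) ** x ** inv\<^bsub>GL2\<^esub> (s (\<rho>bar k))"
    using regular_element by blast
  obtain x y c where D: "trace (s (\<rho>bar k)) = x + y" "det (s (\<rho>bar k)) = x * y" "(x - y) * c = 1"
    using eigenvalues_lift[OF k(2,3)] by metis
  have "\<exists>z\<in>\<Phi>. s (\<rho>bar k) ** g = z ** g ** s (\<rho>bar k)" if g: "g \<in> \<Gamma>" for g
  proof -
    let ?C = "\<Phi> #>\<^bsub>GL2\<lparr>carrier := \<Gamma>\<rparr>\<^esub> g"
    have C: "?C = {z ** g | z. z \<in> \<Phi>}" by (auto simp: r_coset_def)
    have "?C \<in> carrier (GL2\<lparr>carrier := \<Gamma>\<rparr> Mod \<Phi>)"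
      using g by (auto simp: FactGroup_def RCOSETS_def)
    then have "ad_act H \<rho>bar s a ` ?C = ?C" using assms k(1) by blast
    moreover have "g \<in> ?C" unfolding C using one_in_frattini by force
    ultimately have "ad_act H \<rho>bar s a g \<in> ?C" by blast
    then obtain z where z: "z \<in> \<Phi>" "s (\<rho>bar k) ** g ** inv\<^bsub>GL2\<^esub> (s (\<rho>bar k)) = z ** g"
      unfolding C k(4) by blast
    then show ?thesis using conj_eq_iff[OF invertible_s[OF k(2)]] by blast
  qed
  then show ?thesis
    using commute_if_trivial_mod_frattini[OF D] by (intro dihedral_if_commute[OF k(2,3)]) blast
qed

lemma trivial_mod_frattini_if_trivial:
  assumes "\<forall>a\<in>ad_image H \<rho>bar. \<forall>x\<in>\<Gamma>. ad_act H \<rho>bar s a x = x"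
    and a: "a \<in> ad_image H \<rho>bar" and C: "C \<in> carrier (GL2\<lparr>carrier := \<Gamma>\<rparr> Mod \<Phi>)"
  shows "ad_act H \<rho>bar s a ` C = C"
proof -
  have "C \<subseteq> \<Gamma>"
    using C frattini_subset Gamma_mult by (auto simp: FactGroup_def RCOSETS_def r_coset_def)
  then have "ad_act H \<rho>bar s a x = x" if "x \<in> C" for x using assms that by blast
  then show ?thesis by force
qed

lemma product_decomposition:
  assumes dih: "dihedral G T H \<pi> chibar \<rho>"
  shows "topologically_isomorphic
        (GL2\<lparr>carrier := \<Gamma>\<rparr> \<times>\<times> GL2\<lparr>carrier := s ` \<rho>bar ` H\<rparr>)
        (prod_topology (subtopology \<G> \<Gamma>) (subtopology \<G> (s ` \<rho>bar ` H)))
        (GL2\<lparr>carrier := \<rho> ` H\<rparr>) (subtopology \<G> (\<rho> ` H))"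
proof -
  let ?S = "s ` \<rho>bar ` H"
  let ?f = "\<lambda>(x :: 'r ^ 2 ^ 2, y :: 'r ^ 2 ^ 2). x ** y"
  \<comment> \<open>\<open>t\<close> projects to the \<open>s\<close>-component: reduce, then apply
    the splitting.\<close>
  define t where "t z = s (map_matrix \<pi> z)" for z
  let ?g = "\<lambda>z. (z ** inv\<^bsub>GL2\<^esub> (t z), t z)"
  let ?X = "prod_topology (subtopology \<G> \<Gamma>) (subtopology \<G> ?S)"
  have S_sub: "?S \<subseteq> \<rho> ` H" using s_image by blast
  have G_sub: "\<Gamma> \<subseteq> \<rho> ` H" by (rule Gamma_subset_rho_H)
  have inv_H: "invertible z" if "z \<in> \<rho> ` H" for z using that invertible_rho H_carrier by auto
  have mult_H: "x ** y \<in> \<rho> ` H" if "x \<in> \<rho> ` H" "y \<in> \<rho> ` H" for x y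
    using that rho_mult H_carrier subgroup.m_closed[OF subgroup_H] by (smt (verit) imageE imageI)
  have top_X: "topspace ?X = \<Gamma> \<times> ?S" using G_sub S_sub inv_H by auto
  have top_H: "topspace (subtopology \<G> (\<rho> ` H)) = \<rho> ` H" using inv_H by auto
  have t_H: "t (\<rho> h) = s (\<rho>bar h)" if "h \<in> H" for h
    using that rho_lift[OF H_carrier] by (simp add: t_def)
  have g_in: "?g z \<in> \<Gamma> \<times> ?S" if "z \<in> \<rho> ` H" for z
    using that t_H Gamma_part by auto
  have fg: "?f (?g z) = z" if "z \<in> \<rho> ` H" for z
  proof -
    have "invertible (t z)" using that t_H invertible_s by auto
    then show ?thesis using GL2_inv(3) by (metis case_prod_conv matrix_mul_assoc matrix_mul_rid)
  qed
  have gf: "?g (?f (x, y)) = (x, y)" if "x \<in> \<Gamma>" "y \<in> ?S" for x y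
  proof -
    have "map_matrix \<pi> (x ** y) = map_matrix \<pi> y" using that Gamma_residue by (simp add: map_matrix_mult)
    then have "t (x ** y) = y" using that s_lift by (auto simp: t_def)
    moreover have "x ** y ** inv\<^bsub>GL2\<^esub> y = x"
      using GL2_inv(2)[of y] that S_sub inv_H by (metis matrix_mul_assoc matrix_mul_rid subsetD)
    ultimately show ?thesis by simp
  qed
  have cont_f: "continuous_map ?X (subtopology \<G> (\<rho> ` H)) ?f"
  proof (rule continuous_map_into_subtopology)
    have "continuous_map ?X \<G> fst" "continuous_map ?X \<G> snd"
      using continuous_map_into_fulltopology[OF continuous_map_fst]
        continuous_map_into_fulltopology[OF continuous_map_snd] by blast+
    then show "continuous_map ?X \<G> ?f"
      unfolding case_prod_beta by (rule continuous_map_GL2_mult)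
    show "?f \<in> topspace ?X \<rightarrow> \<rho> ` H" unfolding top_X using G_sub S_sub by (auto intro!: mult_H s_image)
  qed
  have cont_g: "continuous_map (subtopology \<G> (\<rho> ` H)) ?X ?g"
  proof -
    let ?Y = "subtopology \<G> (\<rho> ` H)"
    have id: "continuous_map ?Y \<G> (\<lambda>z. z)" by (simp add: continuous_map_from_subtopology)
    have "continuous_map ?Y (subtopology (discrete_topology UNIV) (\<rho>bar ` H)) (map_matrix \<pi>)"
      using continuous_map_residue[OF id] rho_lift H_carrier
      by (intro continuous_map_into_subtopology) (auto simp: top_H)
    then have res: "continuous_map ?Y (discrete_topology (\<rho>bar ` H)) (map_matrix \<pi>)" by simp
    \<comment> \<open>\<open>t\<close> and its inverse factor through a discrete space, so their
      continuity reduces to that of the reduction.\<close>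
    have "continuous_map (discrete_topology (\<rho>bar ` H)) \<G> s"
      using invertible_s by auto
    from continuous_map_compose[OF res this] have t: "continuous_map ?Y \<G> t"
      by (simp add: comp_def t_def[abs_def])
    have "continuous_map (discrete_topology (\<rho>bar ` H)) \<G> (\<lambda>y. inv\<^bsub>GL2\<^esub> (s y))"
      using invertible_s GL2_inv(1) by auto
    from continuous_map_compose[OF res this] have "continuous_map ?Y \<G> (\<lambda>z. inv\<^bsub>GL2\<^esub> (t z))"
      by (simp add: comp_def t_def[abs_def])
    from continuous_map_GL2_mult[OF id this] t show ?thesis
      using g_in by (auto simp: continuous_map_pairwise comp_def top_H intro!: continuous_map_into_subtopology)
  qed
  have "homeomorphic_maps ?X (subtopology \<G> (\<rho> ` H)) ?f ?g"
    unfolding homeomorphic_maps_def top_X top_H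
  proof (intro conjI ballI cont_f cont_g fg)
    fix u assume "u \<in> \<Gamma> \<times> ?S"
    then show "?g (?f u) = u" using gf[of "fst u" "snd u"] by (simp add: mem_Times_iff)
  qed
  then have homeo: "homeomorphic_map ?X (subtopology \<G> (\<rho> ` H)) ?f"
    using homeomorphic_map_maps by blast
  have bij: "bij_betw ?f (\<Gamma> \<times> ?S) (\<rho> ` H)"
    using homeomorphic_imp_surjective_map[OF homeo] homeomorphic_imp_injective_map[OF homeo]
    unfolding bij_betw_def top_X top_H by blast
  define F where "F = ?f"
  have hom: "F (u \<otimes>\<^bsub>GL2\<lparr>carrier := \<Gamma>\<rparr> \<times>\<times> GL2\<lparr>carrier := ?S\<rparr>\<^esub> v) = F u ** F v"
    if "u \<in> \<Gamma> \<times> ?S" "v \<in> \<Gamma> \<times> ?S" for u v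
  proof -
    obtain x y x' y' where uv: "u = (x, y)" "v = (x', y')" by fastforce
    have "y ** x' = x' ** y"
      using that G_sub S_sub uv by (intro rho_H_commute_if_dihedral[OF dih]) auto
    then have "x ** x' ** (y ** y') = x ** y ** (x' ** y')" by (metis matrix_mul_assoc)
    then show ?thesis by (simp add: uv F_def DirProd_def)
  qed
  have carr: "carrier (GL2\<lparr>carrier := \<Gamma>\<rparr> \<times>\<times> GL2\<lparr>carrier := ?S\<rparr>) = \<Gamma> \<times> ?S"
    by (simp add: DirProd_def)
  have "F \<in> hom (GL2\<lparr>carrier := \<Gamma>\<rparr> \<times>\<times> GL2\<lparr>carrier := ?S\<rparr>) (GL2\<lparr>carrier := \<rho> ` H\<rparr>)"
  proof (rule homI, unfold carr)
    fix u v assume uv: "u \<in> \<Gamma> \<times> ?S" "v \<in> \<Gamma> \<times> ?S"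
    have "F u \<in> \<rho> ` H" using uv(1) bij_betwE[OF bij[folded F_def]] by blast
    then show "F u \<in> carrier (GL2\<lparr>carrier := \<rho> ` H\<rparr>)" by simp
    show "F (u \<otimes>\<^bsub>GL2\<lparr>carrier := \<Gamma>\<rparr> \<times>\<times> GL2\<lparr>carrier := ?S\<rparr>\<^esub> v) =
        F u \<otimes>\<^bsub>GL2\<lparr>carrier := \<rho> ` H\<rparr>\<^esub> F v"
      unfolding hom[OF uv] by simp
  qed
  then have "F \<in> iso (GL2\<lparr>carrier := \<Gamma>\<rparr> \<times>\<times> GL2\<lparr>carrier := ?S\<rparr>) (GL2\<lparr>carrier := \<rho> ` H\<rparr>)"
    using bij[folded F_def] by (intro isoI) (simp_all add: carr)
  then show ?thesis unfolding topologically_isomorphic_def using homeo[folded F_def] by blast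
qed

end

theorem theorem1p1:
  fixes p :: nat
    and G :: "('g, 'x) monoid_scheme" and T :: "'g topology"
    and H :: "'g set" and \<sigma> :: 'g
    and chibar :: "'g \<Rightarrow> 'f::{field,finite}" and \<rho>bar :: "'g \<Rightarrow> 'f ^ 2 ^ 2"
    and \<alpha> :: "(nat \<Rightarrow> 'f) \<Rightarrow> 'r::comm_ring_1" and \<pi> :: "'r \<Rightarrow> 'f"
    and \<rho> :: "'g \<Rightarrow> 'r ^ 2 ^ 2" and s :: "'f ^ 2 ^ 2 \<Rightarrow> 'r ^ 2 ^ 2"
  assumes "Factorial_Ring.prime p" and "CHAR('f) = p"
    and "profinite_group G T"
    and "H \<lhd> G" and "openin T H" and "card (rcosets\<^bsub>G\<^esub> H) = 2"
    and "\<sigma> \<in> carrier G - H"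
    and "is_character G T H (discrete_topology UNIV) chibar"
    and "\<exists>h\<in>H. chibar h \<noteq> chibar (\<sigma> \<otimes>\<^bsub>G\<^esub> h \<otimes>\<^bsub>G\<^esub> inv\<^bsub>G\<^esub> \<sigma>)"
    and "\<rho>bar \<in> hom G GL2" and "equivalent_to_Ind G H chibar \<rho>bar"
    and "coefficient_algebra p \<alpha> \<pi>"
    and "is_representation G T adic_topology \<rho>"
    and "\<forall>g\<in>carrier G. map_matrix \<pi> (\<rho> g) = \<rho>bar g"
    and "s \<in> hom (GL2\<lparr>carrier := \<rho>bar ` H\<rparr>) (GL2\<lparr>carrier := \<rho> ` H\<rparr>)"
    and "\<forall>y\<in>\<rho>bar ` H. map_matrix \<pi> (s y) = y"
  defines "\<Gamma> \<equiv> residual_kernel G \<pi> \<rho>bar \<rho>"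
    and "\<G> \<equiv> GL2_topology (adic_topology :: 'r topology)"
  defines "\<Phi> \<equiv> frattini p (GL2\<lparr>carrier := \<Gamma>\<rparr>) (subtopology \<G> \<Gamma>)"
  defines "trivial_on_\<Gamma> \<equiv> \<forall>a\<in>ad_image H \<rho>bar. \<forall>x\<in>\<Gamma>. ad_act H \<rho>bar s a x = x"
    and "trivial_on_\<Gamma>_mod_\<Phi> \<equiv>
      \<forall>a\<in>ad_image H \<rho>bar. \<forall>C\<in>carrier (GL2\<lparr>carrier := \<Gamma>\<rparr> Mod \<Phi>). ad_act H \<rho>bar s a ` C = C"
  shows "(dihedral G T H \<pi> chibar \<rho> \<longleftrightarrow> trivial_on_\<Gamma>) \<and>
    (trivial_on_\<Gamma> \<longleftrightarrow> trivial_on_\<Gamma>_mod_\<Phi>) \<and>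
    (trivial_on_\<Gamma> \<longrightarrow>
      topologically_isomorphic
        (GL2\<lparr>carrier := \<Gamma>\<rparr> \<times>\<times> GL2\<lparr>carrier := s ` \<rho>bar ` H\<rparr>)
        (prod_topology (subtopology \<G> \<Gamma>) (subtopology \<G> (s ` \<rho>bar ` H)))
        (GL2\<lparr>carrier := \<rho> ` H\<rparr>) (subtopology \<G> (\<rho> ` H)))"
proof -
  have char: "of_nat p = (0 :: 'f)"
    using assms(2) of_nat_CHAR[where ?'a = 'f] by simp
  interpret L: residually_dihedral G H \<sigma> p \<alpha> \<pi> T chibar \<rho>bar \<rho> s
    using assms(4,6,7,9-16) char
    by (intro residually_dihedral.intro residually_dihedral_axioms.intro index_two.intro
        coefficient_ring.intro) auto
  note defs = \<Gamma>_def \<G>_def \<Phi>_def trivial_on_\<Gamma>_def trivial_on_\<Gamma>_mod_\<Phi>_def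
  \<comment> \<open>\<open>1\<close>, \<open>4\<close> and \<open>3\<close> form the cycle of
    implications; \<open>2\<close> also supplies the hypothesis of
    \<open>product_decomposition\<close>.\<close>
  have 1: "dihedral G T H \<pi> chibar \<rho> \<Longrightarrow> trivial_on_\<Gamma>"
    unfolding defs using L.trivial_if_dihedral by blast
  have 2: "trivial_on_\<Gamma> \<Longrightarrow> dihedral G T H \<pi> chibar \<rho>"
    unfolding defs by (rule L.dihedral_if_trivial)
  have 3: "trivial_on_\<Gamma>_mod_\<Phi> \<Longrightarrow> dihedral G T H \<pi> chibar \<rho>"
    unfolding defs by (rule L.dihedral_if_trivial_mod_frattini)
  have 4: "trivial_on_\<Gamma> \<Longrightarrow> trivial_on_\<Gamma>_mod_\<Phi>"
    unfolding defs using L.trivial_mod_frattini_if_trivial by blast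
  show ?thesis
    using 1 2 3 4 L.product_decomposition unfolding \<Gamma>_def[symmetric] \<G>_def[symmetric] by blast
qed

end
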